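(* Let $A$ be a real C$^*$-algebra and let $V:A\times A\to\mathbb{R}$ be an orthogonal bounded bilinear form. Then the continuous bilinear form $$\tilde V:M(A)\times M(A)\to\mathbb{R},\qquad \tilde V(a,b):=V^{**}(a,b),$$ is orthogonal.
   Context: A real C$^*$-algebra is a real Banach $*$-algebra $A$ satisfying $\|a^*a\|=\|a\|^2$ for all $a\in A$ and such that $1+a^*a$ is invertible in the unitization of $A$ for every $a\in A$. Elements $a,b$ of a real C$^*$-algebra are orthogonal, $a\perp b$, if $ab^*=b^*a=0$; a bounded bilinear form $V$ with real values on a real C$^*$-algebra is orthogonal if $V(a,b^* )=0$ whenever $a\perp b$. The multiplier algebra $M(A)$ is the set of all $x\in A^{**}$ such that $xa\in A$ and $ax\in A$ for all $a\in A$. $V^{**}:A^{**}\times A^{**}\to\mathbb{R}$ denotes the Arens (Aron-Berner) extension of $V$, i.e. the unique bounded bilinear extension of $V$ which is separately weak$^*$ continuous. *)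

theory Defs
  imports "HOL-Analysis.Analysis"
begin

section \<open>Real C*-algebras\<close>

text \<open>Product of the unitization \<open>A \<oplus> \<real>\<close>, whose unit is \<open>(0, 1)\<close>. If \<open>A\<close> is already unital,
  then \<open>(x, 1)\<close> is invertible here if and only if \<open>1 + x\<close> is invertible in \<open>A\<close>.\<close>

definition (in real_algebra) unitization_mult :: "'a \<times> real \<Rightarrow> 'a \<times> real \<Rightarrow> 'a \<times> real"
  where "unitization_mult x y =
    (fst x * fst y + snd x *\<^sub>R fst y + snd y *\<^sub>R fst x, snd x * snd y)"

definition (in real_algebra) unitization_invertible :: "'a \<times> real \<Rightarrow> bool"
  where "unitization_invertible x \<longleftrightarrow>
    (\<exists>y. unitization_mult x y = (0, 1) \<and> unitization_mult y x = (0, 1))"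

class real_cstar_algebra = real_normed_algebra + banach +
  fixes star :: "'a \<Rightarrow> 'a"
  assumes star_add: "star (a + b) = star a + star b"
    and star_scaleR: "star (r *\<^sub>R a) = r *\<^sub>R star a"
    and star_mult: "star (a * b) = star b * star a"
    and star_star: "star (star a) = a"
    and norm_star_mult_self: "norm (star a * a) = (norm a)\<^sup>2"
    and invertible_one_plus_star_mult_self: "unitization_invertible (star a * a, 1)"


section \<open>Orthogonality\<close>

text \<open>Product, involution and carrier are parameters, so that the same definition applies to
  \<open>A\<close> and to the multiplier algebra as a subset of the bidual.\<close>

definition orthogonal_elems :: "('b \<Rightarrow> 'b \<Rightarrow> 'b::zero) \<Rightarrow> ('b \<Rightarrow> 'b) \<Rightarrow> 'b \<Rightarrow> 'b \<Rightarrow> bool"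
  where "orthogonal_elems mul st a b \<longleftrightarrow> mul a (st b) = 0 \<and> mul (st b) a = 0"

definition orthogonal_form ::
    "'b set \<Rightarrow> ('b \<Rightarrow> 'b \<Rightarrow> 'b::zero) \<Rightarrow> ('b \<Rightarrow> 'b) \<Rightarrow> ('b \<Rightarrow> 'b \<Rightarrow> real) \<Rightarrow> bool"
  where "orthogonal_form S mul st V \<longleftrightarrow>
    (\<forall>a\<in>S. \<forall>b\<in>S. orthogonal_elems mul st a b \<longrightarrow> V a (st b) = 0)"


section \<open>The bidual and the Arens extension\<close>

type_synonym 'a bidual = "('a \<Rightarrow>\<^sub>L real) \<Rightarrow>\<^sub>L real"

definition bidual_embed :: "'a::real_normed_vector \<Rightarrow> 'a bidual"
  where "bidual_embed a = Blinfun (\<lambda>\<phi>. blinfun_apply \<phi> a)"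

text \<open>The iterated limit \<open>lim\<^sub>i lim\<^sub>j V(a\<^sub>i, b\<^sub>j)\<close> for nets \<open>a\<^sub>i \<rightarrow> m\<close> and \<open>b\<^sub>j \<rightarrow> n\<close> in the
  weak* topology. By \<open>arens_ext_unique\<close> below, a separately weak* continuous bounded bilinear
  extension of \<open>V\<close> can only be this one; on real C*-algebras it does have that property.\<close>

definition arens_ext ::
    "('a::real_normed_vector \<Rightarrow> 'b::real_normed_vector \<Rightarrow> real) \<Rightarrow> 'a bidual \<Rightarrow> 'b bidual \<Rightarrow> real"
  where "arens_ext V m n = m (Blinfun (\<lambda>a. n (Blinfun (V a))))"

text \<open>The first Arens product.\<close>

definition bidual_mult :: "'a::real_normed_algebra bidual \<Rightarrow> 'a bidual \<Rightarrow> 'a bidual"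
  where "bidual_mult m n = Blinfun (\<lambda>\<phi>. arens_ext (\<lambda>a b. blinfun_apply \<phi> (a * b)) m n)"

text \<open>The second transpose of the involution.\<close>

definition bidual_star :: "'a::real_cstar_algebra bidual \<Rightarrow> 'a bidual"
  where "bidual_star m = Blinfun (\<lambda>\<phi>. m (Blinfun (\<lambda>a. blinfun_apply \<phi> (star a))))"

definition multiplier_algebra :: "'a::real_normed_algebra bidual set"
  where "multiplier_algebra =
    {x. \<forall>a. bidual_mult x (bidual_embed a) \<in> range bidual_embed \<and>
            bidual_mult (bidual_embed a) x \<in> range bidual_embed}"


section \<open>Basic properties\<close>

text \<open>The functions wrapped in \<open>Blinfun\<close> above are bounded linear.\<close>

lemma bidual_embed_apply [simp]: "blinfun_apply (bidual_embed a) \<phi> = \<phi> a"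
  unfolding bidual_embed_def
  by (simp add: bounded_linear_Blinfun_apply blinfun.bounded_linear_left)

lemma Blinfun_form_apply:
  assumes "bounded_bilinear V"
  shows "blinfun_apply (Blinfun (V a)) b = V a b"
  by (simp add: bounded_linear_Blinfun_apply bounded_bilinear.bounded_linear_right[OF assms])

lemma bounded_linear_Blinfun_form:
  fixes V :: "'a::real_normed_vector \<Rightarrow> 'b::real_normed_vector \<Rightarrow> real"
  assumes "bounded_bilinear V"
  shows "bounded_linear (\<lambda>a. Blinfun (V a))"
proof -
  have "(\<lambda>a. Blinfun (V a)) = bounded_bilinear.prod_right V"
    by (rule ext, rule blinfun_eqI)
      (simp add: Blinfun_form_apply[OF assms] bounded_bilinear.prod_right.rep_eq[OF assms])
  then show ?thesis
    using bounded_bilinear.bounded_linear_prod_right[OF assms] by simp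
qed

lemma arens_ext_eq_compose:
  fixes V :: "'a::real_normed_vector \<Rightarrow> 'b::real_normed_vector \<Rightarrow> real"
  assumes "bounded_bilinear V"
  shows "arens_ext V m n = m (n o\<^sub>L Blinfun (\<lambda>a. Blinfun (V a)))"
proof -
  have "(\<lambda>a. n (Blinfun (V a))) = blinfun_apply (n o\<^sub>L Blinfun (\<lambda>a. Blinfun (V a)))"
    by (rule ext)
      (simp add: bounded_linear_Blinfun_apply[OF bounded_linear_Blinfun_form[OF assms]])
  then show ?thesis
    by (simp add: arens_ext_def blinfun_apply_inverse)
qed

lemma bounded_bilinear_arens_ext:
  fixes V :: "'a::real_normed_vector \<Rightarrow> 'b::real_normed_vector \<Rightarrow> real"
  assumes "bounded_bilinear V"
  shows "bounded_bilinear (arens_ext V)"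
proof -
  have "arens_ext V = (\<lambda>m n. m (n o\<^sub>L Blinfun (\<lambda>a. Blinfun (V a))))"
    by (intro ext arens_ext_eq_compose assms)
  then show ?thesis
    using bounded_bilinear.comp[OF bounded_bilinear_blinfun_apply bounded_linear_ident
        bounded_bilinear.bounded_linear_left[OF bounded_bilinear_blinfun_compose]]
    by simp
qed

lemma arens_ext_embed:
  assumes "bounded_bilinear V"
  shows "arens_ext V (bidual_embed a) (bidual_embed b) = V a b"
  by (simp add: arens_ext_eq_compose[OF assms] Blinfun_form_apply[OF assms]
      bounded_linear_Blinfun_apply[OF bounded_linear_Blinfun_form[OF assms]])

lemma weak_star_functional_of_finite:
  fixes f :: "('v::real_normed_vector \<Rightarrow>\<^sub>L real) \<Rightarrow> real"
  assumes "finite S" "linear f" "\<And>m. (\<forall>x\<in>S. blinfun_apply m x = 0) \<Longrightarrow> f m = 0"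
  shows "\<exists>x. \<forall>m. f m = blinfun_apply m x"
  using assms
proof (induction S arbitrary: f rule: finite_induct)
  case empty
  then show ?case by (intro exI[of _ 0]) (simp add: blinfun.zero_right)
next
  case (insert y S)
  show ?case
  proof (cases "\<exists>k::'v \<Rightarrow>\<^sub>L real. (\<forall>x\<in>S. blinfun_apply k x = 0) \<and> blinfun_apply k y \<noteq> 0")
    case False
    show ?thesis
    proof (rule insert.IH[OF insert.prems(1)])
      fix m :: "'v \<Rightarrow>\<^sub>L real"
      assume "\<forall>x\<in>S. blinfun_apply m x = 0"
      then show "f m = 0" using False by (intro insert.prems(2)) auto
    qed
  next
    case True
    then obtain k :: "'v \<Rightarrow>\<^sub>L real" where k: "\<And>x. x \<in> S \<Longrightarrow> blinfun_apply k x = 0" "blinfun_apply k y \<noteq> 0"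
      by auto
    define c where "c = f k / k y"
    define g where "g m = f m - c * blinfun_apply m y" for m
    have lin: "linear g"
      using insert.prems(1)
      by (auto simp: g_def linear_iff blinfun.bilinear_simps algebra_simps)
    have "g m = 0" if m: "\<forall>x\<in>S. blinfun_apply m x = 0" for m
    proof -
      have "f (m - (m y / k y) *\<^sub>R k) = 0"
        by (rule insert.prems(2)) (use m k in \<open>auto simp: blinfun.bilinear_simps\<close>)
      then show ?thesis
        using linear_diff[OF insert.prems(1)] linear_scale[OF insert.prems(1)]
        by (simp add: g_def c_def)
    qed
    then obtain x where "\<And>m. g m = blinfun_apply m x"
      using insert.IH[OF lin] by blast
    then have "f m = blinfun_apply m (x + c *\<^sub>R y)" for m
      by (simp add: blinfun.bilinear_simps g_def algebra_simps)
    then show ?thesis by blast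
  qed
qed

text \<open>On real-valued bounded linear maps, \<^const>\<open>strong_operator_topology\<close> is the weak* topology.\<close>

lemma weak_star_continuous_functional:
  fixes f :: "('v::real_normed_vector \<Rightarrow>\<^sub>L real) \<Rightarrow> real"
  assumes lin: "linear f" and cont: "continuous_map strong_operator_topology euclideanreal f"
  shows "\<exists>x. \<forall>m. f m = blinfun_apply m x"
proof -
  have "openin strong_operator_topology {m. f m \<in> {-1<..<1}}"
    using openin_continuous_map_preimage[OF cont, of "{-1<..<1}"]
    by (simp add: strong_operator_topology_topspace)
  then obtain U where U: "open U" "{m. f m \<in> {-1<..<1}} = blinfun_apply -` U"
    unfolding strong_operator_topology_def openin_pullback_topology by auto
  have "(0 :: 'v \<Rightarrow>\<^sub>L real) \<in> blinfun_apply -` U"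
    using U(2) linear_0[OF lin] by auto
  then have "openin (product_topology (\<lambda>_. euclidean) UNIV) U" "blinfun_apply 0 \<in> U"
    using U(1) by (auto simp: open_fun_def)
  from product_topology_open_contains_basis[OF this]
  obtain X :: "'v \<Rightarrow> real set" where X: "blinfun_apply 0 \<in> Pi\<^sub>E UNIV X"
      "finite {i. X i \<noteq> UNIV}" "Pi\<^sub>E UNIV X \<subseteq> U"
    by auto
  show ?thesis
  proof (rule weak_star_functional_of_finite[OF X(2) lin])
    fix m :: "'v \<Rightarrow>\<^sub>L real"
    assume m: "\<forall>x\<in>{i. X i \<noteq> UNIV}. blinfun_apply m x = 0"
    have bound: "\<bar>t * f m\<bar> < 1" for t
    proof -
      have "blinfun_apply (t *\<^sub>R m) i \<in> X i" for i
        using m X(1) by (cases "X i = UNIV") (auto simp: blinfun.bilinear_simps PiE_iff)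
      then have "blinfun_apply (t *\<^sub>R m) \<in> U"
        using X(3) by auto
      then have "f (t *\<^sub>R m) \<in> {-1<..<1}"
        using U(2) by blast
      then show ?thesis
        by (simp add: linear_scale[OF lin] abs_less_iff)
    qed
    show "f m = 0"
    proof (rule ccontr)
      assume "f m \<noteq> 0"
      then show False using bound[of "1 / f m"] by simp
    qed
  qed
qed

theorem arens_ext_unique:
  fixes V :: "'a::real_normed_vector \<Rightarrow> 'b::real_normed_vector \<Rightarrow> real"
  assumes V: "bounded_bilinear V" and W: "bounded_bilinear W"
    and extends: "\<And>a b. W (bidual_embed a) (bidual_embed b) = V a b"
    and left: "\<And>n. continuous_map strong_operator_topology euclideanreal (\<lambda>m. W m n)"
    and right: "\<And>m. continuous_map strong_operator_topology euclideanreal (W m)"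
  shows "W = arens_ext V"
proof (rule ext, rule ext)
  fix m n
  have linl: "linear (\<lambda>m. W m n)" for n
    by (intro bounded_linear.linear bounded_bilinear.bounded_linear_left[OF W])
  have linr: "linear (W m)" for m
    by (intro bounded_linear.linear bounded_bilinear.bounded_linear_right[OF W])
  have "W (bidual_embed a) n = blinfun_apply n (Blinfun (V a))" for a
  proof -
    obtain \<psi> where \<psi>: "\<And>n. W (bidual_embed a) n = blinfun_apply n \<psi>"
      using weak_star_continuous_functional[OF linr right] by metis
    have "\<psi> = Blinfun (V a)"
    proof (rule blinfun_eqI)
      fix b
      show "\<psi> b = Blinfun (V a) b"
        using \<psi>[of "bidual_embed b"] extends[of a b] by (simp add: Blinfun_form_apply[OF V])
    qed
    then show ?thesis using \<psi> by simp
  qed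
  moreover obtain \<phi> where \<phi>: "\<And>m. W m n = blinfun_apply m \<phi>"
    using weak_star_continuous_functional[OF linl left] by metis
  ultimately have "blinfun_apply \<phi> a = n (Blinfun (V a))" for a
    using \<phi>[of "bidual_embed a"] by simp
  then have "\<phi> = Blinfun (\<lambda>a. n (Blinfun (V a)))"
    by (metis (no_types, lifting) ext blinfun_apply_inverse)
  then show "W m n = arens_ext V m n"
    by (simp add: \<phi> arens_ext_def)
qed

lemma bounded_bilinear_functional_mult:
  fixes \<phi> :: "'a::real_normed_algebra \<Rightarrow>\<^sub>L real"
  shows "bounded_bilinear (\<lambda>a b. \<phi> (a * b))"
proof -
  have "norm (\<phi> (a * b)) \<le> norm a * norm b * norm \<phi>" for a b
  proof -
    have "norm (\<phi> (a * b)) \<le> norm \<phi> * norm (a * b)"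
      by (rule norm_blinfun)
    also have "\<dots> \<le> norm \<phi> * (norm a * norm b)"
      by (intro mult_left_mono norm_mult_ineq norm_ge_zero)
    finally show ?thesis by (simp add: mult_ac)
  qed
  then have "\<exists>K. \<forall>a b. norm (\<phi> (a * b)) \<le> norm a * norm b * K"
    by blast
  then show ?thesis
    by unfold_locales (auto simp: blinfun.bilinear_simps algebra_simps)
qed

lemma bidual_mult_apply:
  fixes m n :: "'a::real_normed_algebra bidual"
  shows "blinfun_apply (bidual_mult m n) \<phi> =
    arens_ext (\<lambda>a b. blinfun_apply \<phi> (a * b)) m n"
proof -
  define B :: "('a \<Rightarrow>\<^sub>L real) \<Rightarrow> 'a \<Rightarrow>\<^sub>L 'a \<Rightarrow>\<^sub>L real"
    where "B \<phi> = Blinfun (\<lambda>a. Blinfun (\<lambda>b. \<phi> (a * b)))" for \<phi>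
  have B: "B \<phi> a b = \<phi> (a * b)" for \<phi> a b
    by (simp add: B_def bounded_linear_Blinfun_apply
        bounded_linear_Blinfun_form[OF bounded_bilinear_functional_mult]
        Blinfun_form_apply[OF bounded_bilinear_functional_mult])
  have "norm (B \<phi>) \<le> norm \<phi> * 1" for \<phi>
  proof -
    have "norm (B \<phi> a b) \<le> norm \<phi> * norm a * norm b" for a b
    proof -
      have "norm (B \<phi> a b) \<le> norm \<phi> * norm (a * b)"
        unfolding B by (rule norm_blinfun)
      also have "\<dots> \<le> norm \<phi> * (norm a * norm b)"
        by (intro mult_left_mono norm_mult_ineq norm_ge_zero)
      finally show ?thesis by (simp add: mult_ac)
    qed
    then show ?thesis
      by (intro norm_blinfun_bound) auto
  qed
  then have "bounded_linear B"
    by (intro bounded_linear_intro[where K = 1] blinfun_eqI)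
      (auto simp: B blinfun.bilinear_simps)
  then have "bounded_linear (\<lambda>\<phi>. m (n o\<^sub>L B \<phi>))"
    by (intro bounded_linear_compose[OF blinfun.bounded_linear_right]
        bounded_linear_compose[OF
          bounded_bilinear.bounded_linear_right[OF bounded_bilinear_blinfun_compose]])
  moreover have "arens_ext (\<lambda>a b. \<phi> (a * b)) m n = m (n o\<^sub>L B \<phi>)" for \<phi> :: "'a \<Rightarrow>\<^sub>L real"
    unfolding B_def by (rule arens_ext_eq_compose[OF bounded_bilinear_functional_mult])
  ultimately show ?thesis
    by (simp add: bidual_mult_def bounded_linear_Blinfun_apply)
qed

lemma bidual_mult_embed:
  "bidual_mult (bidual_embed a) (bidual_embed b) = bidual_embed (a * b)"
  by (rule blinfun_eqI)
    (simp add: bidual_mult_apply arens_ext_embed[OF bounded_bilinear_functional_mult])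

lemma norm_star_le: "norm (star a) \<le> norm a" for a :: "'a::real_cstar_algebra"
proof (cases "star a = 0")
  case False
  have "norm (star a) * norm (star a) \<le> norm a * norm (star a)"
    using norm_star_mult_self[of "star a"] norm_mult_ineq[of a "star a"]
    by (simp add: star_star power2_eq_square)
  then show ?thesis using False by simp
qed simp

lemma bounded_linear_star: "bounded_linear (star :: 'a::real_cstar_algebra \<Rightarrow> 'a)"
  by (rule bounded_linear_intro[where K = 1]) (auto simp: star_add star_scaleR norm_star_le)

lemma bidual_star_apply:
  "blinfun_apply (bidual_star m) \<phi> = m (\<phi> o\<^sub>L Blinfun star)"
proof -
  have "Blinfun (\<lambda>a. blinfun_apply \<phi> (star a)) = \<phi> o\<^sub>L Blinfun star" for \<phi> :: "'a \<Rightarrow>\<^sub>L real"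
  proof -
    have "(\<lambda>a. \<phi> (star a)) = blinfun_apply (\<phi> o\<^sub>L Blinfun star)"
      by (rule ext) (simp add: bounded_linear_Blinfun_apply[OF bounded_linear_star])
    then show ?thesis by (simp add: blinfun_apply_inverse)
  qed
  then have "bidual_star m = Blinfun (\<lambda>\<phi>. m (\<phi> o\<^sub>L Blinfun star))"
    by (simp add: bidual_star_def)
  moreover have "bounded_linear (\<lambda>\<phi>. m (\<phi> o\<^sub>L Blinfun star))"
    by (intro bounded_linear_compose[OF blinfun.bounded_linear_right]
        bounded_bilinear.bounded_linear_left[OF bounded_bilinear_blinfun_compose])
  ultimately show ?thesis
    by (simp add: bounded_linear_Blinfun_apply)
qed

lemma bidual_star_embed: "bidual_star (bidual_embed a) = bidual_embed (star a)"
  by (rule blinfun_eqI)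
    (simp add: bidual_star_apply bounded_linear_Blinfun_apply[OF bounded_linear_star])

end

theory Submission
  imports Defs
begin

text \<open>
  Put \<open>c = b*\<close>. The hypothesis says that \<open>V z w = 0\<close> whenever \<open>z w = w z = 0\<close> in \<open>A\<close>, and it has to
  be shown that \<open>V** a c = 0\<close> for multipliers with \<open>a c = c a = 0\<close>. The corners \<open>a A a\<close> and \<open>c A c\<close>
  lie in \<open>A\<close> and annihilate each other in both orders, so \<open>V\<close> vanishes on \<open>a A a \<times> c A c\<close>. The number
  \<open>V** a c\<close> is the value of \<open>a\<close> at the functional \<open>x \<mapsto> c (V x)\<close>, so two applications of the following
  principle finish the proof: if a functional \<open>\<psi>\<close> on \<open>A\<close> vanishes on \<open>a A a\<close>, then \<open>a \<psi> = 0\<close>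
  (\<open>multiplier_vanishes\<close>). In other words, a multiplier \<open>a\<close> lies in the weak* closure of \<open>a A a\<close>.

  To see this, choose \<open>e\<close> in \<open>A\<close> such that \<open>\<psi>\<close> is close to \<open>x \<mapsto> \<psi> (x e)\<close> in norm
  (\<open>functional_approximate_unit\<close>); then \<open>a \<psi>\<close> is close to \<open>\<psi> t\<close> for the element \<open>t = a e\<close> of \<open>A\<close>.
  For small \<open>\<epsilon>\<close> the element \<open>q = t t* (\<epsilon> + t t*)\<inverse>\<close> is a contraction with \<open>q t\<close> close to \<open>t\<close>, and it
  has the form \<open>q = t v\<close> (\<open>ex_approximate_unit\<close>). Hence \<open>z = q a = a (e v) a\<close> belongs to \<open>a A a\<close>, and
  \<open>\<psi> z\<close> is close to \<open>\<psi> (z e) = \<psi> (q t)\<close>, which is close to \<open>\<psi> t\<close> and so to \<open>a \<psi>\<close>.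

  Two estimates carry the argument. The first is \<open>\<parallel>h (1 + h)\<inverse>\<parallel> < 1\<close> for \<open>h = a* a\<close>
  (\<open>norm_quasi_inverse_less_one\<close>). The axioms only provide inverses; the bound follows because the norm
  of a self-adjoint element is its spectral radius, and the spectral radius is controlled by an
  averaging argument of Rickart that is carried out with real coefficients only. The second is the
  existence of \<open>e\<close> for a given \<open>\<psi>\<close>: at an element \<open>u\<close> of the unit ball where \<open>\<psi>\<close> almost attains its
  norm, with \<open>u e\<close> close to \<open>u\<close>, the C*-identity shows that \<open>\<parallel>u + s (x - x e)\<parallel>\<close> exceeds \<open>1\<close> by a term
  of order \<open>s\<^sup>2\<close> only, so that \<open>\<psi> (x - x e)\<close> must be small. Finally, the Hahn-Banach theorem is
  what turns \<open>z w = 0\<close> in the bidual into \<open>z w = 0\<close> in \<open>A\<close>.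
\<close>

section \<open>Separation of points by bounded functionals\<close>

definition sublinear :: "('v::real_vector \<Rightarrow> real) \<Rightarrow> bool"
  where "sublinear p \<longleftrightarrow>
    (\<forall>x y. p (x + y) \<le> p x + p y) \<and> (\<forall>r x. 0 \<le> r \<longrightarrow> p (r *\<^sub>R x) = r * p x)"

lemma sublinear_add: "sublinear p \<Longrightarrow> p (x + y) \<le> p x + p y"
  and sublinear_scaleR: "sublinear p \<Longrightarrow> 0 \<le> r \<Longrightarrow> p (r *\<^sub>R x) = r * p x"
  by (simp_all add: sublinear_def)

lemma sublinear_zero: "sublinear p \<Longrightarrow> p 0 = 0"
  using sublinear_scaleR[of p 0 0] by simp

lemma sublinear_minus: "sublinear p \<Longrightarrow> - p (- x) \<le> p x"
  using sublinear_add[of p x "- x"] sublinear_zero[of p] by simp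

lemma sublinearI:
  assumes add: "\<And>x y. p (x + y) \<le> p x + p y" and zero: "p 0 = 0"
    and scaleR: "\<And>r x. 0 < r \<Longrightarrow> p (r *\<^sub>R x) \<le> r * p x"
  shows "sublinear p"
proof -
  have "p (r *\<^sub>R x) = r * p x" if "0 < r" for r x
  proof (rule antisym)
    have "p x \<le> inverse r * p (r *\<^sub>R x)"
      using scaleR[of "inverse r" "r *\<^sub>R x"] that by simp
    then show "r * p x \<le> p (r *\<^sub>R x)"
      using that by (simp add: field_simps)
  qed (rule scaleR[OF that])
  then have "p (r *\<^sub>R x) = r * p x" if "0 \<le> r" for r x
    using that zero by (cases "r = 0") auto
  then show ?thesis using add by (simp add: sublinear_def)
qed

text \<open>Lowering \<open>p\<close> in the direction of \<open>x\<close>: the result is still sublinear, lies below \<open>p\<close>, and its value at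
  \<open>- x\<close> is at most \<open>- p x\<close>. A sublinear functional that cannot be lowered is therefore odd, hence linear;
  and applied to the norm, this construction fixes the value that a norming functional takes at \<open>x\<close>.\<close>

definition lower_along :: "'v::real_vector \<Rightarrow> ('v \<Rightarrow> real) \<Rightarrow> 'v \<Rightarrow> real"
  where "lower_along x p v = (INF t\<in>{0..}. p (v + t *\<^sub>R x) - t * p x)"

lemma lower_along_bounds:
  assumes p: "sublinear p"
  shows "0 \<le> t \<Longrightarrow> lower_along x p v \<le> p (v + t *\<^sub>R x) - t * p x"
    and "bdd_below ((\<lambda>t. p (v + t *\<^sub>R x) - t * p x) ` {0..})"
proof -
  have "- p (- v) \<le> p (v + t *\<^sub>R x) - t * p x" if "0 \<le> t" for t
    using sublinear_add[OF p, of "v + t *\<^sub>R x" "- v"] sublinear_scaleR[OF p that] by simp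
  then show bdd: "bdd_below ((\<lambda>t. p (v + t *\<^sub>R x) - t * p x) ` {0..})"
    by (intro bdd_belowI[of _ "- p (- v)"]) auto
  show "0 \<le> t \<Longrightarrow> lower_along x p v \<le> p (v + t *\<^sub>R x) - t * p x"
    unfolding lower_along_def by (rule cINF_lower[OF bdd]) auto
qed

lemma lower_along_le: "sublinear p \<Longrightarrow> lower_along x p v \<le> p v"
  using lower_along_bounds(1)[of p 0 x v] by simp

lemma lower_along_neg: "sublinear p \<Longrightarrow> lower_along x p (- x) \<le> - p x"
  using lower_along_bounds(1)[of p 1 x "- x"] by (simp add: sublinear_zero)

lemma sublinear_lower_along:
  assumes p: "sublinear p"
  shows "sublinear (lower_along x p)"
proof (rule sublinearI)
  fix v w
  have split: "lower_along x p (v + w) - (p (w + s *\<^sub>R x) - s * p x) \<le> p (v + t *\<^sub>R x) - t * p x"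
    if "0 \<le> s" "0 \<le> t" for s t
  proof -
    have "lower_along x p (v + w) \<le> p ((v + w) + (t + s) *\<^sub>R x) - (t + s) * p x"
      using that by (intro lower_along_bounds p) auto
    moreover have "(v + w) + (t + s) *\<^sub>R x = (v + t *\<^sub>R x) + (w + s *\<^sub>R x)"
      by (simp add: algebra_simps)
    ultimately show ?thesis
      using sublinear_add[OF p, of "v + t *\<^sub>R x" "w + s *\<^sub>R x"] by (simp add: algebra_simps)
  qed
  have "lower_along x p (v + w) - (p (w + s *\<^sub>R x) - s * p x) \<le> lower_along x p v"
    if "0 \<le> s" for s
    using split[OF that] unfolding lower_along_def[of x p v] by (intro cINF_greatest) auto
  then have "lower_along x p (v + w) - lower_along x p v \<le> p (w + s *\<^sub>R x) - s * p x"
    if "0 \<le> s" for s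
    using that by (simp add: algebra_simps)
  then have "lower_along x p (v + w) - lower_along x p v \<le> lower_along x p w"
    unfolding lower_along_def[of x p w] by (intro cINF_greatest) auto
  then show "lower_along x p (v + w) \<le> lower_along x p v + lower_along x p w"
    by simp
next
  show "lower_along x p 0 = 0"
    unfolding lower_along_def by (simp add: sublinear_scaleR[OF p])
next
  fix r :: real and v assume r: "0 < r"
  have "lower_along x p (r *\<^sub>R v) / r \<le> p (v + t *\<^sub>R x) - t * p x" if "0 \<le> t" for t
  proof -
    have "lower_along x p (r *\<^sub>R v) \<le> p (r *\<^sub>R v + (r * t) *\<^sub>R x) - (r * t) * p x"
      using r that by (intro lower_along_bounds p) auto
    also have "r *\<^sub>R v + (r * t) *\<^sub>R x = r *\<^sub>R (v + t *\<^sub>R x)"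
      by (simp add: algebra_simps)
    also have "p \<dots> = r * p (v + t *\<^sub>R x)"
      using r by (intro sublinear_scaleR[OF p]) simp
    finally show ?thesis
      using r by (subst pos_divide_le_eq) (auto simp: algebra_simps)
  qed
  then have "lower_along x p (r *\<^sub>R v) / r \<le> lower_along x p v"
    unfolding lower_along_def[of x p v] by (intro cINF_greatest) auto
  then show "lower_along x p (r *\<^sub>R v) \<le> r * lower_along x p v"
    using r by (simp add: pos_divide_le_eq mult.commute)
qed

lemma minimal_sublinear_imp_linear:
  assumes p: "sublinear p"
    and minimal: "\<And>q. sublinear q \<Longrightarrow> (\<And>v. q v \<le> p v) \<Longrightarrow> q = p"
  shows "linear p"
proof -
  have "lower_along x p = p" for x
    by (rule minimal) (auto intro: sublinear_lower_along lower_along_le p)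
  then have neg: "p (- x) = - p x" for x
    using lower_along_neg[OF p, of x] sublinear_minus[OF p, of x] by simp
  show ?thesis
  proof (rule linearI)
    fix x y
    show "p (x + y) = p x + p y"
      using sublinear_add[OF p, of x y] sublinear_add[OF p, of "- x" "- y"] neg[of "x + y"] neg
      by simp
  next
    fix r x
    show "p (r *\<^sub>R x) = r *\<^sub>R p x"
    proof (cases "0 \<le> r")
      case False
      then show ?thesis
        using sublinear_scaleR[OF p, of "- r" x] neg[of "r *\<^sub>R x"] by simp
    qed (simp add: sublinear_scaleR[OF p])
  qed
qed

text \<open>Hahn-Banach in its sublinear form. The pointwise infimum of a chain of sublinear functionals is
  sublinear, because two members of the chain can be compared before the triangle inequality is used;
  Zorn's lemma then gives a minimal one.\<close>

lemma ex_linear_below_sublinear: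
  fixes p\<^sub>0 :: "'v::real_vector \<Rightarrow> real"
  assumes p\<^sub>0: "sublinear p\<^sub>0"
  shows "\<exists>f. linear f \<and> (\<forall>v. f v \<le> p\<^sub>0 v)"
proof -
  define A where "A = {p. sublinear p \<and> p \<le> p\<^sub>0}"
  let ?R = "relation_of (\<lambda>p q. q \<le> p) A"
  have po: "partial_order_on A ?R"
    by (rule partial_order_on_relation_ofI) auto
  have "\<exists>m\<in>A. \<forall>p\<in>A. p \<le> m \<longrightarrow> p = m"
  proof (rule predicate_Zorn[OF po])
    fix C assume C: "C \<in> Chains ?R"
    then have CA: "p \<in> A" if "p \<in> C" for p
      using that by (auto simp: Chains_def relation_of_def)
    have chain: "p \<le> q \<or> q \<le> p" if "p \<in> C" "q \<in> C" for p q
      using that C by (auto simp: Chains_def relation_of_def)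
    show "\<exists>u\<in>A. \<forall>p\<in>C. u \<le> p"
    proof (cases "C = {}")
      case True
      then show ?thesis using p\<^sub>0 by (auto simp: A_def)
    next
      case False
      define u where "u v = (INF p\<in>C. p v)" for v
      have bdd: "bdd_below ((\<lambda>p. p v) ` C)" for v
      proof (rule bdd_belowI[of _ "- p\<^sub>0 (- v)"])
        fix r assume "r \<in> (\<lambda>p. p v) ` C"
        then obtain p where "p \<in> C" "r = p v" by blast
        then show "- p\<^sub>0 (- v) \<le> r"
          using CA[of p] sublinear_minus[of p v] by (force simp: A_def le_fun_def dest: spec[of _ "- v"])
      qed
      have lower: "u v \<le> p v" if "p \<in> C" for p v
        unfolding u_def using that by (intro cINF_lower bdd)
      have greatest: "z \<le> u v" if "\<And>p. p \<in> C \<Longrightarrow> z \<le> p v" for z v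
        unfolding u_def using that False by (intro cINF_greatest) auto
      have "sublinear u"
      proof (rule sublinearI)
        fix v w
        have pq: "u (v + w) \<le> p v + q w" if C: "p \<in> C" "q \<in> C" for p q
        proof -
          obtain r where r: "r \<in> C" "r \<le> p" "r \<le> q" using chain[OF C] C by blast
          have "u (v + w) \<le> r v + r w"
            using lower[OF r(1), of "v + w"] CA[OF r(1)] sublinear_add[of r v w] by (simp add: A_def)
          also have "\<dots> \<le> p v + q w" using r by (intro add_mono) (auto simp: le_fun_def)
          finally show ?thesis .
        qed
        have "u (v + w) - q w \<le> u v" if "q \<in> C" for q
          using pq[OF _ that] by (intro greatest) (simp add: diff_le_eq)
        then have "u (v + w) - u v \<le> u w"
          by (intro greatest) (simp add: algebra_simps)
        then show "u (v + w) \<le> u v + u w" by simp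
      next
        have "(\<lambda>p. p 0) ` C = {0}"
          using False CA by (auto simp: A_def sublinear_zero intro!: image_eqI)
        then show "u 0 = 0" by (simp add: u_def)
      next
        fix r :: real and v assume r: "0 < r"
        have "u (r *\<^sub>R v) / r \<le> u v"
        proof (rule greatest)
          fix p assume p: "p \<in> C"
          then show "u (r *\<^sub>R v) / r \<le> p v"
            using lower[OF p, of "r *\<^sub>R v"] CA[OF p] r
            by (simp add: A_def sublinear_scaleR pos_divide_le_eq mult.commute)
        qed
        then show "u (r *\<^sub>R v) \<le> r * u v"
          using r by (simp add: pos_divide_le_eq mult.commute)
      qed
      moreover have "u \<le> p\<^sub>0"
      proof -
        obtain p where "p \<in> C" using False by blast
        then have "u \<le> p" "p \<le> p\<^sub>0" using lower CA by (auto simp: le_fun_def A_def)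
        then show ?thesis by (rule order_trans)
      qed
      ultimately show ?thesis using lower by (auto simp: A_def le_fun_def)
    qed
  qed
  then obtain m where m: "sublinear m" "m \<le> p\<^sub>0"
      "\<And>p. sublinear p \<Longrightarrow> p \<le> p\<^sub>0 \<Longrightarrow> p \<le> m \<Longrightarrow> p = m"
    by (auto simp: A_def)
  have "linear m"
  proof (rule minimal_sublinear_imp_linear[OF m(1)])
    fix q assume "sublinear q" "\<And>v. q v \<le> m v"
    then show "q = m"
      using m(2) order_trans[of q m p\<^sub>0] by (intro m(3)) (auto simp: le_fun_def)
  qed
  then show ?thesis using m(2) by (auto simp: le_fun_def)
qed

lemma ex_norming_functional:
  fixes x :: "'v::real_normed_vector"
  shows "\<exists>\<phi> :: 'v \<Rightarrow>\<^sub>L real. \<phi> x = norm x"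
proof -
  have norm: "sublinear (norm :: 'v \<Rightarrow> real)"
    by (simp add: sublinear_def norm_triangle_ineq)
  from ex_linear_below_sublinear[OF sublinear_lower_along[OF norm, of x]]
  obtain f where f: "linear f" "\<And>v. f v \<le> lower_along x norm v" by blast
  have le: "f v \<le> norm v" for v
    using f(2) lower_along_le[OF norm] by (rule order_trans)
  have "norm (f v) \<le> norm v" for v
    using le[of v] le[of "- v"] linear_neg[OF f(1), of v] by (simp add: abs_le_iff)
  then have bl: "bounded_linear f"
    using f(1) by (intro bounded_linear_intro[where K = 1]) (auto simp: linear_add linear_scale)
  have "f (- x) \<le> - norm x"
    using f(2) lower_along_neg[OF norm] by (rule order_trans)
  then have "f x = norm x"
    using le[of x] linear_neg[OF f(1), of x] by simp
  then show ?thesis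
    by (intro exI[of _ "Blinfun f"]) (simp add: bounded_linear_Blinfun_apply bl)
qed

lemma inj_bidual_embed: "inj (bidual_embed :: 'v::real_normed_vector \<Rightarrow> 'v bidual)"
proof (rule injI)
  fix x y :: 'v assume eq: "bidual_embed x = bidual_embed y"
  obtain \<phi> :: "'v \<Rightarrow>\<^sub>L real" where \<phi>: "\<phi> (x - y) = norm (x - y)"
    using ex_norming_functional by blast
  have "\<phi> x = \<phi> y" using arg_cong[OF eq, of "\<lambda>m. blinfun_apply m \<phi>"] by simp
  then show "x = y" using \<phi> by (simp add: blinfun.bilinear_simps)
qed

section \<open>The unitization as a normed algebra\<close>

text \<open>A type of its own, rather than \<open>'a \<times> real\<close> with its Euclidean norm: with the norm \<open>\<parallel>x\<parallel> + \<bar>r\<bar>\<close> the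
  unitization becomes a unital normed algebra that contains \<open>A\<close> isometrically, and general facts about
  such algebras apply. If \<open>A\<close> has a unit already, a new one is adjoined.\<close>

datatype 'a unitization = Unitization (element: 'a) (scalar: real)

instantiation unitization :: (real_normed_algebra) real_normed_algebra_1
begin

definition "0 = Unitization 0 0"
definition "1 = Unitization 0 1"
definition "x + y = Unitization (element x + element y) (scalar x + scalar y)"
definition "x - y = Unitization (element x - element y) (scalar x - scalar y)"
definition "- x = Unitization (- element x) (- scalar x)"
definition "r *\<^sub>R x = Unitization (r *\<^sub>R element x) (r * scalar x)"
definition "x * y = Unitization
  (element x * element y + scalar x *\<^sub>R element y + scalar y *\<^sub>R element x) (scalar x * scalar y)"
definition "norm x = norm (element x) + \<bar>scalar x\<bar>"
definition "dist (x :: 'a unitization) y = norm (x - y)"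
definition "sgn (x :: 'a unitization) = inverse (norm x) *\<^sub>R x"
definition [code del]:
  "uniformity = (INF e\<in>{0 <..}. principal {(x, y :: 'a unitization). dist x y < e})"
definition [code del]: "open (U :: 'a unitization set) \<longleftrightarrow>
  (\<forall>x\<in>U. eventually (\<lambda>(x', y). x' = x \<longrightarrow> y \<in> U) uniformity)"

lemmas unitization_defs =
  zero_unitization_def one_unitization_def plus_unitization_def minus_unitization_def
  uminus_unitization_def scaleR_unitization_def times_unitization_def norm_unitization_def

instance
proof
  fix x y z :: "'a unitization" and r s :: real
  show "norm (x + y) \<le> norm x + norm y"
    using norm_triangle_ineq[of "element x" "element y"]
    by (simp add: unitization_defs)
  have "norm (element (x * y)) \<le>
      norm (element x) * norm (element y) + \<bar>scalar x\<bar> * norm (element y) + \<bar>scalar y\<bar> * norm (element x)"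
    unfolding unitization_defs unitization.sel
    by (intro norm_triangle_le add_mono norm_mult_ineq) auto
  then show "norm (x * y) \<le> norm x * norm y"
    by (simp add: unitization_defs abs_mult algebra_simps)
  show "norm (r *\<^sub>R x) = \<bar>r\<bar> * norm x"
    by (simp add: unitization_defs abs_mult algebra_simps)
  show "norm x = 0 \<longleftrightarrow> x = 0"
    by (cases x) (simp add: unitization_defs add_nonneg_eq_0_iff)
qed (simp_all add: unitization_defs dist_unitization_def sgn_unitization_def
    uniformity_unitization_def open_unitization_def algebra_simps scaleR_add_left)

end

abbreviation adjoin :: "'a \<Rightarrow> 'a::real_normed_algebra unitization"
  where "adjoin a \<equiv> Unitization a 0"

section \<open>Spectral radius in real normed algebras\<close>

text \<open>From \<open>i x - i x\<^sub>0 = i x (f x\<^sub>0 - f x) i x\<^sub>0\<close> one first gets that \<open>i\<close> is bounded near \<open>x\<^sub>0\<close> and then that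
  it is continuous there.\<close>

lemma continuous_on_two_sided_inverse:
  fixes f i :: "'t::topological_space \<Rightarrow> 'b::real_normed_algebra_1"
  assumes f: "continuous_on S f"
    and right: "\<And>x. x \<in> S \<Longrightarrow> f x * i x = 1"
    and left: "\<And>x. x \<in> S \<Longrightarrow> i x * f x = 1"
  shows "continuous_on S i"
  unfolding continuous_on_def
proof
  fix x\<^sub>0 assume x\<^sub>0: "x\<^sub>0 \<in> S"
  let ?F = "at x\<^sub>0 within S"
  have lim: "((\<lambda>x. f x\<^sub>0 - f x) \<longlongrightarrow> 0) ?F"
    using f x\<^sub>0 unfolding continuous_on_def by (auto intro!: tendsto_eq_intros)
  have diff: "i x - i x\<^sub>0 = i x * (f x\<^sub>0 - f x) * i x\<^sub>0" if "x \<in> S" for x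
    using that x\<^sub>0 left[of x] right[of x\<^sub>0] by (simp add: algebra_simps)
  have bound: "norm (i x - i x\<^sub>0) \<le> norm (i x) * norm (f x\<^sub>0 - f x) * norm (i x\<^sub>0)" if "x \<in> S" for x
    unfolding diff[OF that]
    by (meson mult_right_mono norm_ge_zero norm_mult_ineq order_trans)
  have "((\<lambda>x. norm (f x\<^sub>0 - f x) * norm (i x\<^sub>0)) \<longlongrightarrow> 0) ?F"
    using tendsto_mult_left_zero[OF tendsto_norm_zero[OF lim]] .
  then have "\<forall>\<^sub>F x in ?F. norm (f x\<^sub>0 - f x) * norm (i x\<^sub>0) < 1 / 2"
    by (rule order_tendstoD) simp
  then have "\<forall>\<^sub>F x in ?F. norm (i x - i x\<^sub>0) \<le> 2 * norm (i x\<^sub>0) * norm (f x\<^sub>0 - f x) * norm (i x\<^sub>0)"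
  proof (rule eventually_elim2)
    show "\<forall>\<^sub>F x in ?F. x \<in> S" by (simp add: eventually_at_filter)
    fix x assume small: "norm (f x\<^sub>0 - f x) * norm (i x\<^sub>0) < 1 / 2" and x: "x \<in> S"
    have "norm (i x) \<le> norm (i x\<^sub>0) + norm (i x - i x\<^sub>0)"
      by (metis add.commute norm_triangle_sub)
    also have "norm (i x - i x\<^sub>0) \<le> norm (i x) * (1 / 2)"
      using bound[OF x] mult_left_mono[OF less_imp_le[OF small] norm_ge_zero[of "i x"]]
      by (simp add: mult.assoc)
    finally have "norm (i x) \<le> 2 * norm (i x\<^sub>0)" by simp
    then show "norm (i x - i x\<^sub>0) \<le> 2 * norm (i x\<^sub>0) * norm (f x\<^sub>0 - f x) * norm (i x\<^sub>0)"
      using bound[OF x] by (meson mult_right_mono norm_ge_zero order_trans)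
  qed
  moreover have "((\<lambda>x. 2 * norm (i x\<^sub>0) * norm (f x\<^sub>0 - f x) * norm (i x\<^sub>0)) \<longlongrightarrow> 0) ?F"
    by (intro tendsto_mult_left_zero tendsto_mult_right_zero tendsto_norm_zero lim)
  ultimately show "(i \<longlongrightarrow> i x\<^sub>0) ?F"
    by (intro LIM_zero_cancel[of i]) (rule Lim_null_comparison)
qed

text \<open>With \<open>c = cos \<theta>\<close> this is \<open>(1 - t e\<^sup>i\<^sup>\<theta> y) (1 - t e\<^sup>-\<^sup>i\<^sup>\<theta> y)\<close>, the product of two conjugate factors, so its
  invertibility for all \<open>\<theta>\<close> and all \<open>t\<close> in \<open>[0, 1]\<close> says that the complex spectrum of \<open>y\<close> lies in the open
  unit disc.\<close>

definition conj_factors :: "real \<Rightarrow> real \<Rightarrow> 'b::real_normed_algebra_1 \<Rightarrow> 'b"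
  where "conj_factors c t y = 1 - (2 * t * c) *\<^sub>R y + t\<^sup>2 *\<^sub>R (y * y)"

lemma conj_factors_mult_neg:
  "conj_factors c t y * conj_factors (- c) t y = conj_factors (2 * c\<^sup>2 - 1) (t\<^sup>2) (y * y)"
  unfolding conj_factors_def
  by (simp add: algebra_simps power2_eq_square scaleR_2 flip: scaleR_add_left) 

lemma conj_factors_commute:
  "conj_factors c t y * conj_factors d t y = conj_factors d t y * conj_factors c t y"
  unfolding conj_factors_def
  by (simp add: algebra_simps)

lemma conj_factors_average:
  "(1 - (t * c) *\<^sub>R y) * conj_factors (- c) t y + (1 + (t * c) *\<^sub>R y) * conj_factors c t y =
    2 *\<^sub>R (1 - (t\<^sup>2 * (2 * c\<^sup>2 - 1)) *\<^sub>R (y * y))"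
  unfolding conj_factors_def
  by (simp add: algebra_simps power2_eq_square scaleR_2 flip: scaleR_add_left)

text \<open>The witnesses \<open>g\<close> and \<open>g'\<close> are the real parts of \<open>(1 - t e\<^sup>i\<^sup>\<theta> y)\<inverse>\<close> and \<open>(1 - e\<^sup>i\<^sup>\<theta> y)\<inverse>\<close>, where
  \<open>c = cos \<theta>\<close>. They are described by equations instead of inverses, because this form is
  inherited by averages without any discussion of uniqueness.\<close>

definition nearby_resolvents :: "real \<Rightarrow> real \<Rightarrow> 'b::real_normed_algebra_1 \<Rightarrow> bool"
  where "nearby_resolvents \<delta> t y \<longleftrightarrow> (\<forall>c\<in>{-1..1}. \<exists>g g' u.
    g * conj_factors c t y = 1 - (t * c) *\<^sub>R y \<and>
    g' * conj_factors c 1 y = 1 - c *\<^sub>R y \<and>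
    conj_factors c 1 y * u = 1 \<and> norm (g - g') \<le> \<delta>)"

text \<open>The identity \<open>2 (1 - w\<^sup>2 y\<^sup>2)\<inverse> = (1 - w y)\<inverse> + (1 + w y)\<inverse>\<close>, read on real parts: squaring \<open>e\<^sup>i\<^sup>\<theta>\<close> replaces
  \<open>c\<close> by \<open>2 c\<^sup>2 - 1\<close>, and the average of two solutions for \<open>y\<close> is a solution for \<open>y\<^sup>2\<close>. Averaging cannot
  increase distances, so the bound \<open>\<delta>\<close> survives arbitrarily many squarings.\<close>

lemma nearby_resolvents_square:
  assumes near: "nearby_resolvents \<delta> t y"
  shows "nearby_resolvents \<delta> (t\<^sup>2) (y * y)"
  unfolding nearby_resolvents_def
proof
  fix c :: real assume c: "c \<in> {-1..1}"
  define b where "b = sqrt ((1 + c) / 2)"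
  have b: "2 * b\<^sup>2 - 1 = c" "b \<in> {-1..1}" "- b \<in> {-1..1}"
    using c by (auto simp: b_def real_le_lsqrt real_sqrt_ge_zero field_simps intro: order_trans[of _ 0])
  let ?D = "\<lambda>c t. conj_factors c t y"
  obtain g g' u where g: "g * ?D b t = 1 - (t * b) *\<^sub>R y" "g' * ?D b 1 = 1 - b *\<^sub>R y"
      "?D b 1 * u = 1" "norm (g - g') \<le> \<delta>"
    using near b(2) unfolding nearby_resolvents_def by blast
  obtain k k' v where k: "k * ?D (- b) t = 1 + (t * b) *\<^sub>R y" "k' * ?D (- b) 1 = 1 + b *\<^sub>R y"
      "?D (- b) 1 * v = 1" "norm (k - k') \<le> \<delta>"
    using near b(3) unfolding nearby_resolvents_def by fastforce
  have avg: "((1 / 2) *\<^sub>R (l + m)) * conj_factors c (s\<^sup>2) (y * y) = 1 - (s\<^sup>2 * c) *\<^sub>R (y * y)"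
    if l: "l * ?D b s = 1 - (s * b) *\<^sub>R y" and m: "m * ?D (- b) s = 1 + (s * b) *\<^sub>R y" for l m s
  proof -
    have D: "conj_factors c (s\<^sup>2) (y * y) = ?D b s * ?D (- b) s"
      using conj_factors_mult_neg[of b s y] by (simp add: b)
    have "(l + m) * conj_factors c (s\<^sup>2) (y * y) = l * ?D b s * ?D (- b) s + m * ?D (- b) s * ?D b s"
      unfolding D distrib_right using conj_factors_commute[of b s y "- b"] by (simp add: mult.assoc)
    also have "\<dots> = 2 *\<^sub>R (1 - (s\<^sup>2 * c) *\<^sub>R (y * y))"
      unfolding l m using conj_factors_average[of s b y] by (simp add: b)
    finally show ?thesis by simp
  qed
  show "\<exists>g g' u. g * conj_factors c (t\<^sup>2) (y * y) = 1 - (t\<^sup>2 * c) *\<^sub>R (y * y) \<and>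
      g' * conj_factors c 1 (y * y) = 1 - c *\<^sub>R (y * y) \<and>
      conj_factors c 1 (y * y) * u = 1 \<and> norm (g - g') \<le> \<delta>"
  proof (intro exI conjI)
    show "(1 / 2) *\<^sub>R (g + k) * conj_factors c (t\<^sup>2) (y * y) = 1 - (t\<^sup>2 * c) *\<^sub>R (y * y)"
      by (rule avg[OF g(1) k(1)])
    show "(1 / 2) *\<^sub>R (g' + k') * conj_factors c 1 (y * y) = 1 - c *\<^sub>R (y * y)"
      using avg[of g' 1 k'] g(2) k(2) by simp
    show "conj_factors c 1 (y * y) * (v * u) = 1"
    proof -
      have "conj_factors c 1 (y * y) * (v * u) = ?D b 1 * (?D (- b) 1 * v) * u"
        using conj_factors_mult_neg[of b 1 y, symmetric] by (simp add: b mult.assoc)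
      then show ?thesis using g(3) k(3) by simp
    qed
    have "norm ((g - g') + (k - k')) \<le> \<delta> + \<delta>"
      using g(4) k(4) by (rule norm_triangle_mono)
    moreover have "(1 / 2) *\<^sub>R (g + k) - (1 / 2) *\<^sub>R (g' + k') = (1 / 2) *\<^sub>R ((g - g') + (k - k'))"
      by (simp add: algebra_simps)
    ultimately show "norm ((1 / 2) *\<^sub>R (g + k) - (1 / 2) *\<^sub>R (g' + k')) \<le> \<delta>"
      by simp
  qed
qed

lemma nearby_resolvents_power:
  assumes "nearby_resolvents \<delta> t y"
  shows "nearby_resolvents \<delta> (t ^ 2 ^ k) (y ^ 2 ^ k)"
proof (induction k)
  case 0
  then show ?case using assms by simp
next
  case (Suc k)
  from nearby_resolvents_square[OF this] show ?case
    by (simp add: power_mult_distrib power2_eq_square mult_2 flip: power_add)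
qed

text \<open>For small \<open>t\<close> the first resolvent is close to \<open>1\<close>, hence so is \<open>(1 - y)\<inverse>\<close>. But
  \<open>y = ((1 - y)\<inverse> - 1) (1 - y)\<close> then has norm less than \<open>1\<close>.\<close>

lemma not_nearby_resolvents:
  fixes y :: "'b::real_normed_algebra_1"
  assumes near: "nearby_resolvents (1 / 4) t y" and y: "norm y = 1" and t: "0 \<le> t" "t \<le> 1 / 32"
  shows False
proof -
  obtain g g' u where g: "g * conj_factors 1 t y = 1 - t *\<^sub>R y"
      "g' * conj_factors 1 1 y = 1 - y" "conj_factors 1 1 y * u = 1" "norm (g - g') \<le> 1 / 4"
    using near[unfolded nearby_resolvents_def, rule_format, of 1] by auto
  have sq: "conj_factors 1 1 y = (1 - y) * (1 - y)"
    by (simp add: conj_factors_def algebra_simps scaleR_2)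
  \<comment> \<open>The right inverse \<open>(1 - y) u\<close> of \<open>1 - y\<close> cancels one factor in \<open>g' (1 - y) (1 - y) = 1 - y\<close>.\<close>
  have inv: "g' * (1 - y) = 1"
    by (metis g(2,3) sq mult.assoc mult.right_neutral)
  have "g - 1 = (2 * t) *\<^sub>R (g * y) - t\<^sup>2 *\<^sub>R (g * (y * y)) - t *\<^sub>R y"
    using g(1) by (simp add: conj_factors_def algebra_simps)
  also have "norm \<dots> \<le> 2 * t * norm g + t\<^sup>2 * norm g + t"
  proof (intro norm_triangle_le_diff add_mono)
    have gy: "norm (g * y) \<le> norm g" "norm (g * (y * y)) \<le> norm g"
      using norm_mult_ineq[of g y] norm_mult_ineq[of "g * y" y] y by (auto simp: mult.assoc)
    then show "norm ((2 * t) *\<^sub>R (g * y)) \<le> 2 * t * norm g"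
      using t by (simp add: mult_left_mono)
    show "norm (t\<^sup>2 *\<^sub>R (g * (y * y))) \<le> t\<^sup>2 * norm g"
      using gy by (simp add: mult_left_mono)
  qed (use t y in simp)
  also have "t\<^sup>2 * norm g \<le> t * norm g"
    using t by (intro mult_right_mono) (auto simp: power2_eq_square mult_left_le)
  finally have "norm (g - 1) \<le> 3 * (t * norm g) + t" by simp
  also have "t * norm g \<le> (1 / 32) * norm g"
    using t by (intro mult_right_mono) auto
  finally have "norm (g - 1) \<le> 3 / 32 * norm g + 1 / 32" using t by simp
  moreover have "norm g \<le> norm (g - 1) + 1"
    using norm_triangle_sub[of g 1] by simp
  ultimately have "norm (g - 1) \<le> 1 / 7" by simp
  then have E: "norm (g' - 1) < 1 / 2"
    using norm_triangle_ineq[of "g' - g" "g - 1"] g(4) by (simp add: norm_minus_commute)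
  have "y = (g' - 1) * (1 - y)"
    using inv by (simp add: left_diff_distrib)
  then have "norm y \<le> norm (g' - 1) * norm (1 - y)"
    by (metis norm_mult_ineq)
  also have "norm (1 - y) \<le> 2"
    using norm_triangle_ineq4[of 1 y] y by simp
  finally show False using y E by (simp add: mult_left_mono)
qed

text \<open>After rescaling, suppose \<open>\<parallel>y\<parallel> = 1\<close>. By compactness the resolvents at radius \<open>t\<close> and at radius \<open>1\<close> are
  uniformly close for some \<open>t < 1\<close>. Repeated squaring keeps them close, while \<open>t\<close> is replaced by
  \<open>t\<^sup>n \<rightarrow> 0\<close> and \<open>y\<close> by \<open>y\<^sup>n\<close> of norm \<open>1\<close>, with \<open>n = 2\<^sup>k\<close>; this is impossible.\<close>

lemma norm_less_one_if_conj_factors_invertible: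
  fixes y :: "'b::real_normed_algebra_1"
  assumes invertible: "\<And>c t. \<bar>c\<bar> \<le> 1 \<Longrightarrow> 0 \<le> t \<Longrightarrow> t \<le> 1 \<Longrightarrow>
      \<exists>u. conj_factors c t y * u = 1 \<and> u * conj_factors c t y = 1"
    and norm_power: "\<And>k. norm (y ^ 2 ^ k) = norm y ^ 2 ^ k"
  shows "norm y < 1"
proof (rule ccontr)
  assume "\<not> norm y < 1"
  then have y: "norm y \<ge> 1" by simp
  \<comment> \<open>Division by a norm that is at least one keeps the parameter \<open>t\<close> in the unit interval.\<close>
  define z where "z = y /\<^sub>R norm y"
  have z: "norm z = 1" "norm (z ^ 2 ^ k) = 1" for k
    using y norm_power by (auto simp: z_def power_inverse intro!: left_inverse)
  let ?S = "{-1..1} \<times> {0..1::real}"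
  have "\<exists>u. conj_factors (fst p) (snd p) z * u = 1 \<and> u * conj_factors (fst p) (snd p) z = 1"
    if "p \<in> ?S" for p
  proof -
    have "conj_factors (fst p) (snd p) z = conj_factors (fst p) (snd p / norm y) y"
      by (simp add: conj_factors_def z_def divide_inverse power2_eq_square mult_ac)
    then show ?thesis
      using invertible[of "fst p" "snd p / norm y"] that y by (auto simp: divide_le_eq abs_le_iff)
  qed
  then obtain i where i: "\<And>p. p \<in> ?S \<Longrightarrow>
      conj_factors (fst p) (snd p) z * i p = 1 \<and> i p * conj_factors (fst p) (snd p) z = 1"
    by metis
  define G where "G p = (1 - (snd p * fst p) *\<^sub>R z) * i p" for p
  have "continuous_on ?S i"
  proof (rule continuous_on_two_sided_inverse)
    show "continuous_on ?S (\<lambda>p. conj_factors (fst p) (snd p) z)"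
      unfolding conj_factors_def by (intro continuous_intros)
  qed (use i in auto)
  then have "continuous_on ?S G"
    unfolding G_def by (intro continuous_intros)
  then have "uniformly_continuous_on ?S G"
    by (intro compact_uniformly_continuous compact_Times) auto
  then obtain d where d: "d > 0"
      "\<And>p p'. p \<in> ?S \<Longrightarrow> p' \<in> ?S \<Longrightarrow> dist p' p < d \<Longrightarrow> dist (G p') (G p) < 1 / 4"
    unfolding uniformly_continuous_on_def by (metis zero_less_divide_1_iff zero_less_numeral)
  define t where "t = max 0 (1 - d / 2)"
  have t: "0 \<le> t" "t < 1" "1 - t < d" using d(1) by (auto simp: t_def)
  have "nearby_resolvents (1 / 4) t z"
    unfolding nearby_resolvents_def
  proof
    fix c :: real assume c: "c \<in> {-1..1}"
    then have p: "(c, t) \<in> ?S" "(c, 1) \<in> ?S" using t by auto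
    have "dist (c, t) (c, 1) < d"
      using t by (simp add: dist_Pair_Pair dist_real_def)
    from d(2)[OF p(2,1) this] have "norm (G (c, t) - G (c, 1)) \<le> 1 / 4"
      by (simp add: dist_norm)
    moreover have "G (c, s) * conj_factors c s z = 1 - (s * c) *\<^sub>R z" if "(c, s) \<in> ?S" for s
      using i[OF that] by (simp add: G_def mult.assoc)
    ultimately show "\<exists>g g' u. g * conj_factors c t z = 1 - (t * c) *\<^sub>R z \<and>
        g' * conj_factors c 1 z = 1 - c *\<^sub>R z \<and> conj_factors c 1 z * u = 1 \<and> norm (g - g') \<le> 1 / 4"
      using p i[OF p(2)] by (metis fst_conv mult_1 snd_conv)
  qed
  then have near: "nearby_resolvents (1 / 4) (t ^ 2 ^ k) (z ^ 2 ^ k)" for k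
    by (rule nearby_resolvents_power)
  obtain n where n: "t ^ n < 1 / 32"
    using real_arch_pow_inv[of "1/32" t] t by auto
  have "n \<le> 2 ^ n" by (simp add: less_imp_le)
  then have "t ^ 2 ^ n \<le> t ^ n"
    using t by (intro power_decreasing) auto
  then show False
    using not_nearby_resolvents[OF near z(2), of n] n t by simp
qed

section \<open>Approximate units in real C*-algebras\<close>

lemma star_diff: "star (a - b) = star a - star b" for a b :: "'a::real_cstar_algebra"
  by (rule linear_diff[OF bounded_linear.linear[OF bounded_linear_star]])

lemma invertible_one_plus_adjoin:
  "\<exists>u. (1 + adjoin (star a * a)) * u = 1 \<and> u * (1 + adjoin (star a * a)) = 1"
  for a :: "'a::real_cstar_algebra"
proof -
  obtain x s where "unitization_mult (star a * a, 1) (x, s) = (0, 1)"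
      "unitization_mult (x, s) (star a * a, 1) = (0, 1)"
    using invertible_one_plus_star_mult_self[of a] unfolding unitization_invertible_def by auto
  then show ?thesis
    by (intro exI[of _ "Unitization x s"]) (auto simp: unitization_defs unitization_mult_def add_ac)
qed

text \<open>The element \<open>q = h (1 + h)\<inverse> = 1 - (1 + h)\<inverse>\<close>, described without reference to a unit. It is
  self-adjoint because \<open>q*\<close> satisfies the mirrored equations, and a left and a right solution agree.\<close>

lemma ex_quasi_inverse:
  fixes a :: "'a::real_cstar_algebra"
  defines "h \<equiv> star a * a"
  shows "\<exists>q. q + h * q = h \<and> q + q * h = h \<and> star q = q"
proof -
  obtain u where u: "(1 + adjoin h) * u = 1" "u * (1 + adjoin h) = 1"
    using invertible_one_plus_adjoin[of a] unfolding h_def by blast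
  define q where "q = - element u"
  have "scalar u = 1"
    using arg_cong[OF u(1), of scalar] by (simp add: unitization_defs)
  then have "h + (element u + h * element u) = 0" "h + (element u + element u * h) = 0"
    using arg_cong[OF u(1), of element] arg_cong[OF u(2), of element]
    by (simp_all add: unitization_defs add_ac)
  then have q: "q + h * q = h" "q + q * h = h"
    by (simp_all add: q_def eq_neg_iff_add_eq_0[symmetric])
  have star_h: "star h = h" by (simp add: h_def star_mult star_star)
  define p where "p = star q"
  have p: "p + p * h = h"
    using arg_cong[OF q(1), of star] by (simp add: p_def star_add star_mult star_h)
  have "p * (h - q) = (h - p) * q"
    using q(1) p by (metis add_diff_cancel_left' mult.assoc)
  then have "p * h = h * q" by (simp add: algebra_simps)
  then have "p = q" using p q(1) by (metis add_right_cancel)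
  then show ?thesis using q by (auto simp: p_def)
qed

lemma inverse_one_plus_adjoin:
  fixes h q :: "'a::real_normed_algebra"
  assumes "q + h * q = h" "q + q * h = h"
  shows "(1 + adjoin h) * (1 - adjoin q) = 1" "(1 - adjoin q) * (1 + adjoin h) = 1"
  using assms by (simp_all add: unitization_defs algebra_simps)

lemma left_inverse_eq_right_inverse:
  fixes d l r :: "'b::monoid_mult"
  assumes "l * d = 1" "d * r = 1"
  shows "l = r"
  by (metis assms mult.assoc mult_1 mult_1_right)

text \<open>With \<open>X = 1 + h\<close>, so that \<open>q X = h\<close>, the element \<open>1 - 2 t c q + t\<^sup>2 q\<^sup>2\<close> times \<open>X\<^sup>2\<close> equals
  \<open>(1 + \<delta> h)\<^sup>2 + m\<^sup>2 h\<^sup>2\<close> for \<open>\<delta> = 1 - t c \<ge> 0\<close> and \<open>m\<^sup>2 = t\<^sup>2 (1 - c\<^sup>2)\<close>. This is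
  \<open>(1 + b\<^sup>2) (1 + \<delta> h)\<^sup>2\<close> for the self-adjoint element \<open>b = m h (1 + \<delta> h)\<inverse>\<close> of \<open>A\<close>, and both factors are
  invertible by the axiom on \<open>1 + a* a\<close>, since \<open>\<delta> h\<close> is again of the form \<open>a* a\<close>.\<close>

lemma conj_factors_quasi_inverse_invertible:
  fixes a q :: "'a::real_cstar_algebra"
  defines "h \<equiv> star a * a"
  assumes q: "q + h * q = h" "q + q * h = h"
    and c: "\<bar>c\<bar> \<le> 1" and t: "0 \<le> t" "t \<le> 1"
  shows "\<exists>u. conj_factors c t (adjoin q) * u = 1 \<and> u * conj_factors c t (adjoin q) = 1"
proof -
  define \<delta> where "\<delta> = 1 - t * c"
  define m where "m = t * sqrt (1 - c\<^sup>2)"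
  have "t * c \<le> 1" using c t by (simp add: abs_le_iff mult_le_one mult_left_le_one_le
        order_trans[OF mult_left_mono[of c 1 t]])
  then have \<delta>: "\<delta> \<ge> 0" by (simp add: \<delta>_def)
  have m: "m\<^sup>2 = t\<^sup>2 * (1 - c\<^sup>2)"
    using c by (simp add: m_def power_mult_distrib abs_square_le_1)
  have star_h: "star h = h" by (simp add: h_def star_mult star_star)
  have "star (sqrt \<delta> *\<^sub>R a) * (sqrt \<delta> *\<^sub>R a) = \<delta> *\<^sub>R h"
    using \<delta> by (simp add: h_def star_scaleR)
  with ex_quasi_inverse[of "sqrt \<delta> *\<^sub>R a"] obtain p where
    p: "p + (\<delta> *\<^sub>R h) * p = \<delta> *\<^sub>R h" "p + p * (\<delta> *\<^sub>R h) = \<delta> *\<^sub>R h" "star p = p"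
    by metis
  have comm: "h * p = p * h"
  proof (cases "\<delta> = 0")
    case True
    then show ?thesis using p by simp
  next
    case False
    have "\<delta> *\<^sub>R (h * p) = \<delta> *\<^sub>R (p * h)"
      using p(1,2) by (metis add_left_cancel mult_scaleR_left mult_scaleR_right)
    then show ?thesis using False by simp
  qed
  \<comment> \<open>Here \<open>1 - p\<close> is the inverse of \<open>1 + \<delta> h\<close>.\<close>
  define b where "b = m *\<^sub>R (h - h * p)"
  have star_b: "star b = b"
    by (simp add: b_def star_scaleR star_diff star_mult star_h p(3) comm)
  have "adjoin (star b * b) = adjoin b * adjoin b"
    by (simp add: star_b unitization_defs)
  then obtain Y where Y: "(1 + adjoin b * adjoin b) * Y = 1" "Y * (1 + adjoin b * adjoin b) = 1"
    using invertible_one_plus_adjoin[of b] by metis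
  define H Q X W X\<^sub>\<delta> B where "H = adjoin h" and "Q = adjoin q" and "X = 1 + adjoin h"
    and "W = 1 - adjoin p" and "X\<^sub>\<delta> = 1 + \<delta> *\<^sub>R adjoin h" and "B = adjoin b"
  have XX: "X\<^sub>\<delta> * W = 1" "W * X\<^sub>\<delta> = 1"
    using inverse_one_plus_adjoin[OF p(1,2)] by (simp_all add: X\<^sub>\<delta>_def W_def unitization_defs)
  have QX: "Q * X = H" "X * Q = H"
    using q by (simp_all add: Q_def X_def H_def unitization_defs add.commute)
  have HW: "H * W = W * H" "B = m *\<^sub>R (H * W)"
    using comm by (simp_all add: H_def W_def B_def b_def unitization_defs)
  let ?D = "conj_factors c t Q"
  have DXX: "?D * (X * X) = X\<^sub>\<delta> * X\<^sub>\<delta> + m\<^sup>2 *\<^sub>R (H * H)"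
  proof -
    have "Q * (X * X) = H * X" "Q * Q * (X * X) = H * H"
      using QX by (metis mult.assoc)+
    then have "?D * (X * X) = X * X - (2 * t * c) *\<^sub>R (H * X) + t\<^sup>2 *\<^sub>R (H * H)"
      by (simp add: conj_factors_def algebra_simps)
    also have "\<dots> = 1 + (\<delta> *\<^sub>R H + \<delta> *\<^sub>R H) + (\<delta>\<^sup>2 + m\<^sup>2) *\<^sub>R (H * H)"
      unfolding m \<delta>_def X_def H_def[symmetric]
      by (simp add: algebra_simps power2_eq_square scaleR_2) (simp flip: scaleR_add_left)
    also have "\<dots> = X\<^sub>\<delta> * X\<^sub>\<delta> + m\<^sup>2 *\<^sub>R (H * H)"
      by (simp add: X\<^sub>\<delta>_def H_def[symmetric] algebra_simps power2_eq_square scaleR_2)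
    finally show ?thesis .
  qed
  have "H * W * X\<^sub>\<delta> = H" "X\<^sub>\<delta> * (H * W) = H"
    using XX(2) mult.assoc[of X\<^sub>\<delta> W H] by (simp add: mult.assoc, simp add: HW(1) XX(1))
  then have BX: "B * X\<^sub>\<delta> = m *\<^sub>R H" "X\<^sub>\<delta> * B = m *\<^sub>R H"
    by (simp_all add: HW(2))
  then have BXX: "(1 + B * B) * (X\<^sub>\<delta> * X\<^sub>\<delta>) = X\<^sub>\<delta> * X\<^sub>\<delta> + m\<^sup>2 *\<^sub>R (H * H)"
    "(X\<^sub>\<delta> * X\<^sub>\<delta>) * (1 + B * B) = X\<^sub>\<delta> * X\<^sub>\<delta> + m\<^sup>2 *\<^sub>R (H * H)"
  proof -
    have "B * B * (X\<^sub>\<delta> * X\<^sub>\<delta>) = (B * X\<^sub>\<delta>) * (B * X\<^sub>\<delta>)" "X\<^sub>\<delta> * X\<^sub>\<delta> * (B * B) = (B * X\<^sub>\<delta>) * (B * X\<^sub>\<delta>)"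
      using BX by (metis mult.assoc)+
    then show "(1 + B * B) * (X\<^sub>\<delta> * X\<^sub>\<delta>) = X\<^sub>\<delta> * X\<^sub>\<delta> + m\<^sup>2 *\<^sub>R (H * H)"
      "(X\<^sub>\<delta> * X\<^sub>\<delta>) * (1 + B * B) = X\<^sub>\<delta> * X\<^sub>\<delta> + m\<^sup>2 *\<^sub>R (H * H)"
      by (simp_all add: BX algebra_simps power2_eq_square)
  qed
  have XQ: "X * Q = Q * X"
    by (simp add: QX)
  have XQQ: "X * (Q * Q) = Q * (Q * X)"
    unfolding mult.assoc[symmetric] XQ unfolding mult.assoc XQ ..
  have XD: "X * ?D = ?D * X"
    by (simp add: conj_factors_def distrib_left distrib_right left_diff_distrib
        right_diff_distrib mult.assoc XQ XQQ)
  have "?D * (X * X * W * W * Y) = (?D * (X * X)) * W * W * Y"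
    by (simp add: mult.assoc)
  also have "\<dots> = (1 + B * B) * (X\<^sub>\<delta> * (X\<^sub>\<delta> * W) * W) * Y"
    unfolding DXX BXX(1)[symmetric] by (simp add: mult.assoc)
  also have "\<dots> = 1" using Y XX by (simp add: B_def)
  finally have right: "?D * (X * X * W * W * Y) = 1" .
  have "(Y * W * W * X * X) * ?D = Y * W * W * (?D * (X * X))"
    using XD by (metis mult.assoc)
  also have "\<dots> = Y * (W * (W * X\<^sub>\<delta>) * X\<^sub>\<delta>) * (1 + B * B)"
    unfolding DXX BXX(2)[symmetric] by (simp add: mult.assoc)
  also have "\<dots> = 1" using Y XX by (simp add: B_def)
  finally have left: "(Y * W * W * X * X) * ?D = 1" .
  have "Y * W * W * X * X = X * X * W * W * Y"
    by (rule left_inverse_eq_right_inverse[OF left right])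
  then show ?thesis using left right unfolding Q_def by metis
qed

text \<open>For self-adjoint \<open>q\<close> the C*-identity gives \<open>\<parallel>q\<^sup>2\<parallel> = \<parallel>q\<parallel>\<^sup>2\<close>, so the norm is the spectral radius.\<close>

lemma norm_quasi_inverse_less_one:
  fixes a q :: "'a::real_cstar_algebra"
  assumes q: "q + star a * a * q = star a * a" "q + q * (star a * a) = star a * a"
    and star: "star q = q"
  shows "norm q < 1"
proof -
  have "norm (adjoin q) < 1"
  proof (rule norm_less_one_if_conj_factors_invertible)
    have "\<exists>r. adjoin q ^ 2 ^ k = adjoin r \<and> star r = r \<and> norm r = norm q ^ 2 ^ k" for k
    proof (induction k)
      case 0
      then show ?case using star by simp
    next
      case (Suc k)
      then obtain r where r: "adjoin q ^ 2 ^ k = adjoin r" "star r = r" "norm r = norm q ^ 2 ^ k"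
        by blast
      have "norm (r * r) = (norm r)\<^sup>2"
        using norm_star_mult_self[of r] r(2) by simp
      then show ?case
        using r by (intro exI[of _ "r * r"])
          (simp add: star_mult mult_2 power_add, simp add: unitization_defs power2_eq_square)
    qed
    then show "norm (adjoin q ^ 2 ^ k) = norm (adjoin q) ^ 2 ^ k" for k
      by (metis abs_zero add.right_neutral norm_unitization_def unitization.sel)
  qed (use conj_factors_quasi_inverse_invertible[OF q] in blast)
  then show ?thesis by (simp add: norm_unitization_def)
qed

text \<open>Take \<open>e = h (1 + h)\<inverse>\<close> for \<open>h = \<epsilon>\<inverse> u* u\<close>. Then \<open>\<parallel>u - u e\<parallel>\<^sup>2 = \<epsilon> \<parallel>e - e\<^sup>2\<parallel>\<close>, which is at most \<open>2 \<epsilon>\<close> because \<open>e\<close> is a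
  contraction. That \<open>e\<close> lies in \<open>u* A\<close> is what later places the approximants of a multiplier \<open>a\<close> in
  the corner \<open>a A a\<close>.\<close>

lemma ex_approximate_unit:
  fixes u :: "'a::real_cstar_algebra"
  assumes "\<eta> > 0"
  shows "\<exists>e v. star e = e \<and> norm e \<le> 1 \<and> norm (u - u * e) \<le> \<eta> \<and> e = star u * v"
proof -
  define \<epsilon> where "\<epsilon> = \<eta>\<^sup>2 / 2"
  have \<epsilon>: "\<epsilon> > 0" using assms by (simp add: \<epsilon>_def)
  define a where "a = (1 / sqrt \<epsilon>) *\<^sub>R u"
  define h where "h = star a * a"
  have h: "h = (1 / \<epsilon>) *\<^sub>R (star u * u)" "\<epsilon> *\<^sub>R h = star u * u"
    using \<epsilon> by (simp_all add: h_def a_def star_scaleR)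
  obtain q where q: "q + h * q = h" "q + q * h = h" "star q = q"
    using ex_quasi_inverse[of a] unfolding h_def by blast
  have norm_q: "norm q \<le> 1"
    using norm_quasi_inverse_less_one q unfolding h_def by (metis less_imp_le)
  have star_u: "star (u - u * q) = star u - q * star u"
    by (simp add: star_diff star_mult q(3))
  define S where "S = star u * u"
  have "star (u - u * q) * (u - u * q) = (S - S * q) - q * (S - S * q)"
    by (simp add: star_u S_def algebra_simps)
  also have "\<dots> = \<epsilon> *\<^sub>R ((h - h * q) - q * (h - h * q))"
    by (simp add: S_def h(2)[symmetric] algebra_simps)
  also have "h - h * q = q" using q(1) by (simp add: diff_eq_eq)
  finally have "(norm (u - u * q))\<^sup>2 = \<epsilon> * norm (q - q * q)"
    using \<epsilon> by (simp flip: norm_star_mult_self)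
  also have "norm (q - q * q) \<le> 1 + 1 * 1"
    by (intro norm_triangle_le_diff add_mono order_trans[OF norm_mult_ineq] mult_mono norm_q) auto
  finally have "(norm (u - u * q))\<^sup>2 \<le> \<eta>\<^sup>2"
    using \<epsilon> by (simp add: \<epsilon>_def)
  then have "norm (u - u * q) \<le> \<eta>"
    using assms by (simp add: power2_le_iff_abs_le)
  moreover have "q = star u * ((1 / \<epsilon>) *\<^sub>R (u - u * q))"
    using q(1) unfolding h(1) by (simp add: algebra_simps)
  ultimately show ?thesis using norm_q q(3) by blast
qed

section \<open>Approximate units for bounded functionals\<close>

lemma norm_star: "norm (star a) = norm a" for a :: "'a::real_cstar_algebra"
  using norm_star_le[of a] norm_star_le[of "star a"] by (simp add: star_star)

lemma norm_self_mult_star: "norm (a * star a) = (norm a)\<^sup>2" for a :: "'a::real_cstar_algebra"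
  using norm_star_mult_self[of "star a"] by (simp add: star_star norm_star)

lemma ex_almost_norming:
  fixes \<psi> :: "'a::real_normed_vector \<Rightarrow>\<^sub>L real"
  assumes "\<delta> > 0"
  shows "\<exists>u. norm u \<le> 1 \<and> norm \<psi> - \<delta> \<le> \<psi> u"
proof (rule ccontr)
  assume "\<not> ?thesis"
  then have less: "\<psi> u < norm \<psi> - \<delta>" if "norm u \<le> 1" for u
    using that by force
  have "norm (\<psi> x) \<le> (norm \<psi> - \<delta>) * norm x" for x
  proof (cases "x = 0")
    case False
    then have "\<psi> (x /\<^sub>R norm x) < norm \<psi> - \<delta>" "\<psi> (- (x /\<^sub>R norm x)) < norm \<psi> - \<delta>"
      by (auto intro!: less)
    then show ?thesis
      using False by (simp add: blinfun.bilinear_simps field_simps abs_le_iff)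
  qed (simp add: blinfun.bilinear_simps)
  moreover have "0 \<le> norm \<psi> - \<delta>"
    using less[of 0] by (simp add: blinfun.bilinear_simps)
  ultimately have "norm \<psi> \<le> norm \<psi> - \<delta>"
    by (intro norm_blinfun_bound) auto
  then show False using assms by simp
qed

text \<open>Let \<open>\<psi> u \<ge> \<parallel>\<psi>\<parallel> - s\<^sup>2\<close> with \<open>\<parallel>u\<parallel> \<le> 1\<close>, let \<open>u e\<close> be within \<open>s\<close> of \<open>u\<close>, and put \<open>r = x - x e\<close> with
  \<open>\<parallel>x\<parallel> \<le> 1\<close>. In \<open>\<parallel>u + s r\<parallel>\<^sup>2 = \<parallel>(u + s r) (u + s r)*\<parallel>\<close> the mixed terms are of order \<open>s\<^sup>2\<close>, because
  \<open>u r* = (u - u e) x*\<close>. So \<open>\<parallel>\<psi>\<parallel> - s\<^sup>2 + s \<psi> r \<le> \<psi> (u + s r) \<le> \<parallel>\<psi>\<parallel> (1 + 3 s\<^sup>2)\<close>, and division by \<open>s\<close> gives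
  a bound on \<open>\<psi> r\<close> of order \<open>s\<close>.\<close>

lemma functional_approximate_unit:
  fixes \<psi> :: "'a::real_cstar_algebra \<Rightarrow>\<^sub>L real"
  assumes "\<eta> > 0"
  shows "\<exists>e. \<forall>x. \<bar>\<psi> (x - x * e)\<bar> \<le> \<eta> * norm x"
proof -
  define s where "s = \<eta> / (1 + 3 * norm \<psi>)"
  have "0 < 1 + 3 * norm \<psi>" by (simp add: add_pos_nonneg)
  then have s: "s > 0" "s * (1 + 3 * norm \<psi>) = \<eta>"
    using assms by (simp_all add: s_def)
  obtain u where u: "norm u \<le> 1" "norm \<psi> - s\<^sup>2 \<le> \<psi> u"
    using ex_almost_norming[of "s\<^sup>2" \<psi>] s by auto
  obtain e where e: "star e = e" "norm e \<le> 1" "norm (u - u * e) \<le> s"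
    using ex_approximate_unit[OF s(1), of u] by blast
  have upper: "\<psi> (x - x * e) \<le> \<eta>" if x: "norm x \<le> 1" for x
  proof -
    define r where "r = x - x * e"
    have "norm (x * e) \<le> 1"
      using norm_mult_ineq[of x e] mult_le_one[OF x norm_ge_zero e(2)] by linarith
    then have r: "norm r \<le> 2"
      using x norm_triangle_ineq4[of x "x * e"] by (simp add: r_def)
    have "u * star r = (u - u * e) * star x"
      by (simp add: r_def star_diff star_mult e(1) algebra_simps)
    then have "norm (u * star r) \<le> norm (u - u * e) * norm (star x)"
      by (simp add: norm_mult_ineq)
    also have "\<dots> \<le> s * 1"
      using e(3) x s by (intro mult_mono) (auto simp: norm_star)
    finally have cross: "norm (u * star r) \<le> s" by simp
    have "star (u * star r) = r * star u" by (simp add: star_mult star_star)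
    then have cross': "norm (r * star u) \<le> s" using cross by (metis norm_star)
    have "(u + s *\<^sub>R r) * star (u + s *\<^sub>R r) =
        u * star u + s *\<^sub>R (u * star r) + s *\<^sub>R (r * star u) + s\<^sup>2 *\<^sub>R (r * star r)"
      by (simp add: star_add star_scaleR algebra_simps power2_eq_square)
    also have "norm \<dots> \<le> (norm u)\<^sup>2 + s * s + s * s + s\<^sup>2 * (norm r)\<^sup>2"
      using s cross cross'
      by (intro norm_triangle_mono) (auto simp: norm_self_mult_star mult_left_mono)
    also have "\<dots> \<le> 1\<^sup>2 + s * s + s * s + s\<^sup>2 * 2\<^sup>2"
      using u r s by (intro add_mono mult_left_mono power_mono) auto
    also have "\<dots> \<le> (1 + 3 * s\<^sup>2)\<^sup>2"
      using zero_le_power2[of "s\<^sup>2"] by (simp add: power2_eq_square algebra_simps)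
    finally have "(norm (u + s *\<^sub>R r))\<^sup>2 \<le> (1 + 3 * s\<^sup>2)\<^sup>2"
      by (simp add: norm_self_mult_star)
    then have "norm (u + s *\<^sub>R r) \<le> 1 + 3 * s\<^sup>2"
      by (rule power2_le_imp_le) simp
    then have "norm \<psi> * norm (u + s *\<^sub>R r) \<le> norm \<psi> * (1 + 3 * s\<^sup>2)"
      by (intro mult_left_mono) auto
    then have "\<psi> (u + s *\<^sub>R r) \<le> norm \<psi> * (1 + 3 * s\<^sup>2)"
      using norm_blinfun[of \<psi> "u + s *\<^sub>R r"] by (simp add: abs_le_iff)
    then have "s * \<psi> r \<le> s * (s * (1 + 3 * norm \<psi>))"
      using u(2) by (simp add: blinfun.bilinear_simps power2_eq_square algebra_simps)
    then show ?thesis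
      using s by (simp add: r_def)
  qed
  have "\<bar>\<psi> (x - x * e)\<bar> \<le> \<eta> * norm x" for x
  proof (cases "x = 0")
    case False
    define z where "z = x /\<^sub>R norm x"
    have "\<psi> (z - z * e) \<le> \<eta>" "\<psi> (- z - (- z) * e) \<le> \<eta>"
      by (rule upper, simp add: z_def False)+
    moreover have "\<psi> (z - z * e) = \<psi> (x - x * e) / norm x"
      "\<psi> (- z - (- z) * e) = - (\<psi> (x - x * e) / norm x)"
      by (simp_all add: z_def blinfun.bilinear_simps divide_inverse algebra_simps)
    ultimately have "\<bar>\<psi> (x - x * e) / norm x\<bar> \<le> \<eta>"
      by (simp only: abs_le_iff)
    then show ?thesis
      using False by (simp add: divide_le_eq)
  qed (simp add: blinfun.bilinear_simps)
  then show ?thesis by blast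
qed

section \<open>Multipliers in the bidual\<close>

lemma Blinfun_slice_apply:
  fixes V :: "'v::real_normed_vector \<Rightarrow> 'w::real_normed_vector \<Rightarrow> real"
  assumes "bounded_bilinear V"
  shows "Blinfun (\<lambda>a. blinfun_apply n (Blinfun (V a))) a = n (Blinfun (V a))"
  by (intro bounded_linear_Blinfun_apply[THEN fun_cong]
      bounded_linear_compose[OF blinfun.bounded_linear_right bounded_linear_Blinfun_form[OF assms]])

lemma Blinfun_mult_right_apply: "Blinfun (\<lambda>y. blinfun_apply \<phi> (x * y)) z = \<phi> (x * z)"
  for \<phi> :: "'a::real_normed_algebra \<Rightarrow>\<^sub>L real"
  by (rule Blinfun_form_apply[OF bounded_bilinear_functional_mult])

lemma Blinfun_mult_left_apply: "Blinfun (\<lambda>y. blinfun_apply \<phi> (y * x)) z = \<phi> (z * x)"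
  for \<phi> :: "'a::real_normed_algebra \<Rightarrow>\<^sub>L real"
  by (intro bounded_linear_Blinfun_apply[THEN fun_cong]
      bounded_bilinear.bounded_linear_left[OF bounded_bilinear_functional_mult])

lemma bidual_mult_assoc: "bidual_mult (bidual_mult m n) p = bidual_mult m (bidual_mult n p)"
  for m n p :: "'a::real_normed_algebra bidual"
proof (rule blinfun_eqI)
  fix \<phi> :: "'a \<Rightarrow>\<^sub>L real"
  note slice = Blinfun_slice_apply[OF bounded_bilinear_functional_mult]
  show "bidual_mult (bidual_mult m n) p \<phi> = bidual_mult m (bidual_mult n p) \<phi>"
    by (simp add: bidual_mult_apply arens_ext_def slice Blinfun_mult_right_apply mult.assoc)
qed

lemma bidual_mult_zero:
  fixes m :: "'a::real_normed_algebra bidual"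
  shows "bidual_mult m 0 = 0" "bidual_mult 0 m = 0"
  by (auto intro!: blinfun_eqI simp: bidual_mult_apply
      bounded_bilinear.zero_left[OF bounded_bilinear_arens_ext[OF bounded_bilinear_functional_mult]]
      bounded_bilinear.zero_right[OF bounded_bilinear_arens_ext[OF bounded_bilinear_functional_mult]])

lemma bidual_mult_embed_left_apply:
  "bidual_mult (bidual_embed x) m \<phi> = m (Blinfun (\<lambda>y. \<phi> (x * y)))"
  by (simp add: bidual_mult_apply arens_ext_def
      Blinfun_slice_apply[OF bounded_bilinear_functional_mult])

lemma bidual_mult_embed_right_apply:
  "bidual_mult m (bidual_embed x) \<phi> = m (Blinfun (\<lambda>y. \<phi> (y * x)))"
  by (simp add: bidual_mult_apply arens_ext_def Blinfun_mult_right_apply)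

lemma Blinfun_comp_star_apply: "(\<phi> o\<^sub>L Blinfun star) x = \<phi> (star x)"
  for x :: "'a::real_cstar_algebra"
  by (simp add: bounded_linear_Blinfun_apply[OF bounded_linear_star])

text \<open>In general the involution turns the first Arens product into the second one with the factors
  exchanged. When one factor comes from \<open>A\<close>, both products agree, so that the involution maps
  multipliers to multipliers.\<close>

lemma bidual_star_mult_embed:
  "bidual_mult (bidual_star m) (bidual_embed x) = bidual_star (bidual_mult (bidual_embed (star x)) m)"
proof (rule blinfun_eqI)
  fix \<phi> :: "'a \<Rightarrow>\<^sub>L real"
  have "Blinfun (\<lambda>y. \<phi> (y * x)) o\<^sub>L Blinfun star = Blinfun (\<lambda>y. (\<phi> o\<^sub>L Blinfun star) (star x * y))"
    by (rule blinfun_eqI)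
      (subst Blinfun_mult_right_apply,
        simp only: Blinfun_comp_star_apply Blinfun_mult_left_apply star_mult star_star)
  then show "bidual_mult (bidual_star m) (bidual_embed x) \<phi> =
      bidual_star (bidual_mult (bidual_embed (star x)) m) \<phi>"
    by (simp only: bidual_mult_embed_left_apply bidual_mult_embed_right_apply bidual_star_apply)
qed

lemma embed_mult_bidual_star:
  "bidual_mult (bidual_embed x) (bidual_star m) = bidual_star (bidual_mult m (bidual_embed (star x)))"
proof (rule blinfun_eqI)
  fix \<phi> :: "'a \<Rightarrow>\<^sub>L real"
  have "Blinfun (\<lambda>y. \<phi> (x * y)) o\<^sub>L Blinfun star = Blinfun (\<lambda>y. (\<phi> o\<^sub>L Blinfun star) (y * star x))"
    by (rule blinfun_eqI)
      (subst Blinfun_mult_left_apply,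
        simp only: Blinfun_comp_star_apply Blinfun_mult_right_apply star_mult star_star)
  then show "bidual_mult (bidual_embed x) (bidual_star m) \<phi> =
      bidual_star (bidual_mult m (bidual_embed (star x))) \<phi>"
    by (simp only: bidual_mult_embed_left_apply bidual_mult_embed_right_apply bidual_star_apply)
qed

lemma multiplier_algebra_star:
  assumes "m \<in> multiplier_algebra"
  shows "bidual_star m \<in> multiplier_algebra"
  unfolding multiplier_algebra_def
proof (intro CollectI allI conjI)
  fix x
  obtain y z where "bidual_mult (bidual_embed (star x)) m = bidual_embed y"
      "bidual_mult m (bidual_embed (star x)) = bidual_embed z"
    using assms unfolding multiplier_algebra_def by blast
  then show "bidual_mult (bidual_star m) (bidual_embed x) \<in> range bidual_embed"
    "bidual_mult (bidual_embed x) (bidual_star m) \<in> range bidual_embed"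
    by (simp_all add: bidual_star_mult_embed embed_mult_bidual_star bidual_star_embed)
qed

text \<open>The weak* density of the corner \<open>a A a\<close> at \<open>a\<close>. In the proof \<open>\<delta>\<close> is the error functional
  \<open>\<psi> - \<psi> (\<cdot> e)\<close>, and \<open>\<delta> z\<close> is estimated through \<open>\<delta> z = (q a) \<delta> = a (\<delta> (q \<cdot>))\<close>, which is bounded by
  \<open>\<parallel>a\<parallel> \<parallel>\<delta>\<parallel> \<parallel>q\<parallel>\<close>.\<close>

lemma multiplier_approximation:
  fixes a :: "'a::real_cstar_algebra bidual"
  assumes a: "a \<in> multiplier_algebra" and \<eta>: "\<eta> > 0"
  shows "\<exists>y z. bidual_embed z = bidual_mult (bidual_mult a (bidual_embed y)) a \<and>
    \<bar>a \<psi> - \<psi> z\<bar> \<le> \<eta>"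
proof -
  have pos: "0 < 1 + 2 * norm a + norm \<psi>" by (simp add: add_pos_nonneg)
  define \<kappa> where "\<kappa> = \<eta> / (1 + 2 * norm a + norm \<psi>)"
  have \<kappa>: "\<kappa> > 0" "\<kappa> * (1 + 2 * norm a + norm \<psi>) = \<eta>"
    using \<eta> pos by (simp_all add: \<kappa>_def)
  obtain e where e: "\<And>x. \<bar>\<psi> (x - x * e)\<bar> \<le> \<kappa> * norm x"
    using functional_approximate_unit[OF \<kappa>(1), of \<psi>] by blast
  define \<delta> where "\<delta> = \<psi> - Blinfun (\<lambda>x. \<psi> (x * e))"
  have \<delta>: "\<delta> x = \<psi> (x - x * e)" for x
    by (simp add: \<delta>_def blinfun.bilinear_simps Blinfun_mult_left_apply)
  have norm_\<delta>: "norm \<delta> \<le> \<kappa>"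
    using \<kappa>(1) e by (intro norm_blinfun_bound) (auto simp: \<delta>)
  obtain t where t: "bidual_mult a (bidual_embed e) = bidual_embed t"
    using a unfolding multiplier_algebra_def by blast
  obtain q v where q: "star q = q" "norm q \<le> 1" "norm (star t - star t * q) \<le> \<kappa>" "q = t * v"
    using ex_approximate_unit[OF \<kappa>(1), of "star t"] by (metis star_star)
  have "star (star t - star t * q) = t - q * t"
    by (simp add: star_diff star_mult star_star q(1))
  then have qt: "norm (t - q * t) \<le> \<kappa>"
    using q(3) by (metis norm_star)
  obtain z where z: "bidual_mult (bidual_embed q) a = bidual_embed z"
    using a unfolding multiplier_algebra_def by blast
  \<comment> \<open>The approximant: \<open>z = q a = t v a = a (e v) a\<close>.\<close>
  have "bidual_mult a (bidual_embed (e * v)) = bidual_embed q"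
    by (simp add: q(4) t flip: bidual_mult_embed bidual_mult_assoc)
  then have aya: "bidual_embed z = bidual_mult (bidual_mult a (bidual_embed (e * v))) a"
    by (simp add: z)
  have ze: "\<psi> (z * e) = \<psi> (q * t)"
  proof -
    have "bidual_embed (z * e) = bidual_mult (bidual_mult (bidual_embed q) a) (bidual_embed e)"
      by (simp add: z bidual_mult_embed)
    also have "\<dots> = bidual_embed (q * t)"
      by (simp add: bidual_mult_assoc t bidual_mult_embed)
    finally show ?thesis by (metis bidual_embed_apply)
  qed
  have "a \<psi> = a \<delta> + a (Blinfun (\<lambda>x. \<psi> (x * e)))"
    by (simp add: \<delta>_def blinfun.bilinear_simps)
  also have "a (Blinfun (\<lambda>x. \<psi> (x * e))) = \<psi> t"
    by (simp flip: bidual_mult_embed_right_apply add: t)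
  finally have a\<psi>: "a \<psi> = a \<delta> + \<psi> t" .
  have \<psi>z: "\<psi> z = \<delta> z + \<psi> (q * t)"
    by (simp add: \<delta> blinfun.bilinear_simps ze)
  have a\<delta>: "\<bar>a \<delta>\<bar> \<le> \<kappa> * norm a"
    using norm_blinfun[of a \<delta>] mult_left_mono[OF norm_\<delta> norm_ge_zero[of a]]
    by (simp add: mult.commute)
  have \<delta>z: "\<bar>\<delta> z\<bar> \<le> \<kappa> * norm a"
  proof -
    have "norm (Blinfun (\<lambda>y. \<delta> (q * y))) \<le> \<kappa>"
    proof (rule norm_blinfun_bound)
      fix y
      have "norm (q * y) \<le> 1 * norm y"
        using q(2) by (intro order_trans[OF norm_mult_ineq] mult_right_mono) auto
      then have "norm \<delta> * norm (q * y) \<le> \<kappa> * norm y"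
        using \<kappa>(1) by (intro mult_mono norm_\<delta>) auto
      then show "norm (Blinfun (\<lambda>y. \<delta> (q * y)) y) \<le> \<kappa> * norm y"
        using norm_blinfun[of \<delta> "q * y"] by (simp add: Blinfun_mult_right_apply)
    qed (use \<kappa> in simp)
    then have "norm a * norm (Blinfun (\<lambda>y. \<delta> (q * y))) \<le> norm a * \<kappa>"
      by (rule mult_left_mono) simp
    moreover have "\<delta> z = a (Blinfun (\<lambda>y. \<delta> (q * y)))"
      by (simp flip: bidual_mult_embed_left_apply add: z)
    ultimately show ?thesis
      using norm_blinfun[of a "Blinfun (\<lambda>y. \<delta> (q * y))"] by (simp add: mult.commute)
  qed
  have "\<bar>\<psi> (t - q * t)\<bar> \<le> \<kappa> * norm \<psi>"
    using norm_blinfun[of \<psi> "t - q * t"] mult_left_mono[OF qt norm_ge_zero[of \<psi>]]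
    by (simp add: mult.commute)
  then have "\<bar>a \<psi> - \<psi> z\<bar> \<le> \<kappa> * norm a + \<kappa> * norm a + \<kappa> * norm \<psi>"
    using a\<delta> \<delta>z unfolding a\<psi> \<psi>z by (simp add: blinfun.bilinear_simps)
  also have "\<dots> \<le> \<eta>"
    using \<kappa> by (simp add: algebra_simps)
  finally show ?thesis using aya by blast
qed

lemma multiplier_vanishes:
  fixes a :: "'a::real_cstar_algebra bidual" and \<psi> :: "'a \<Rightarrow>\<^sub>L real"
  assumes a: "a \<in> multiplier_algebra"
    and vanish: "\<And>y z. bidual_embed z = bidual_mult (bidual_mult a (bidual_embed y)) a \<Longrightarrow> \<psi> z = 0"
  shows "a \<psi> = 0"
proof (rule ccontr)
  assume "a \<psi> \<noteq> 0"
  then have "\<bar>a \<psi>\<bar> / 2 > 0" by simp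
  from multiplier_approximation[OF a this, of \<psi>] obtain y z where
    "bidual_embed z = bidual_mult (bidual_mult a (bidual_embed y)) a" "\<bar>a \<psi> - \<psi> z\<bar> \<le> \<bar>a \<psi>\<bar> / 2"
    by blast
  with vanish[OF this(1)] \<open>a \<psi> \<noteq> 0\<close> show False by simp
qed

text \<open>The product \<open>(a m a) (c n c)\<close> contains the factor \<open>a c\<close>.\<close>

lemma corner_mult_eq_zero:
  fixes a c :: "'a::real_normed_algebra bidual"
  assumes ac: "bidual_mult a c = 0"
    and z: "bidual_embed z = bidual_mult (bidual_mult a m) a"
    and w: "bidual_embed w = bidual_mult (bidual_mult c n) c"
  shows "z * w = 0"
proof -
  have "bidual_embed (z * w) = bidual_mult (bidual_mult (bidual_mult a m) a) (bidual_mult (bidual_mult c n) c)"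
    by (simp add: z w flip: bidual_mult_embed)
  also have "\<dots> = bidual_mult (bidual_mult (bidual_mult (bidual_mult a m) (bidual_mult a c)) n) c"
    by (simp add: bidual_mult_assoc)
  also have "\<dots> = 0"
    by (simp add: ac bidual_mult_zero)
  also have "(0 :: 'a bidual) = bidual_embed 0"
    by (rule blinfun_eqI) (simp add: blinfun.bilinear_simps)
  finally show ?thesis
    by (rule injD[OF inj_bidual_embed])
qed

section \<open>The extension to the multiplier algebra\<close>

theorem proposition1p3:
  fixes V :: "'a::real_cstar_algebra \<Rightarrow> 'a \<Rightarrow> real"
  assumes "bounded_bilinear V"
    and "orthogonal_form UNIV (*) star V"
  shows "orthogonal_form multiplier_algebra bidual_mult bidual_star (arens_ext V)"
  unfolding orthogonal_form_def orthogonal_elems_def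
proof (intro ballI impI, elim conjE)
  fix a b :: "'a bidual"
  assume a: "a \<in> multiplier_algebra" and b: "b \<in> multiplier_algebra"
  define c where "c = bidual_star b"
  assume "bidual_mult a (bidual_star b) = 0" "bidual_mult (bidual_star b) a = 0"
  then have ac: "bidual_mult a c = 0" "bidual_mult c a = 0" by (simp_all add: c_def)
  have c: "c \<in> multiplier_algebra"
    unfolding c_def by (rule multiplier_algebra_star[OF b])
  have V0: "V z w = 0" if "z * w = 0" "w * z = 0" for z w
    using assms(2)[unfolded orthogonal_form_def orthogonal_elems_def, rule_format, of z "star w"] that
    by (simp add: star_star)
  have "a (Blinfun (\<lambda>x. c (Blinfun (V x)))) = 0"
  proof (rule multiplier_vanishes[OF a])
    fix y z assume z: "bidual_embed z = bidual_mult (bidual_mult a (bidual_embed y)) a"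
    \<comment> \<open>The same principle in the second variable, with \<open>z\<close> in \<open>a A a\<close> fixed.\<close>
    have "c (Blinfun (V z)) = 0"
    proof (rule multiplier_vanishes[OF c])
      fix y' w assume w: "bidual_embed w = bidual_mult (bidual_mult c (bidual_embed y')) c"
      have "V z w = 0"
        using corner_mult_eq_zero[OF ac(1) z w] corner_mult_eq_zero[OF ac(2) w z] by (rule V0)
      then show "Blinfun (V z) w = 0"
        by (simp add: Blinfun_form_apply[OF assms(1)])
    qed
    then show "Blinfun (\<lambda>x. c (Blinfun (V x))) z = 0"
      by (simp add: Blinfun_slice_apply[OF assms(1)])
  qed
  then show "arens_ext V a (bidual_star b) = 0"
    by (simp add: arens_ext_def c_def)
qed

end
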